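(* Let $G$ be a $6$-dimensional $2$-step nilpotent Lie group with $b_1\ge4$, endowed with a left-invariant non-parallelizable complex structure $J$ and a left-invariant $(1,0)$-coframe $\{\zeta^1,\zeta^2,\zeta^3\}$ satisfying $d\zeta^1=d\zeta^2=0$, $d\zeta^3=\rho\,\zeta^{12}+\zeta^{1\bar1}+\lambda\,\zeta^{1\bar2}+(x+iy)\,\zeta^{2\bar2}$ ($x,y,\lambda\in\mathbb R$, $\lambda\ge0$, $\rho\in\{0,1\}$). Let $\omega_0$ be a left-invariant Hermitian metric on $(G,J)$ and let $K_1=K_1(\omega_0)$ be the constant in the ODE $\frac{d}{dt}r(t)^2=K_1+\frac{K_2}{r(t)^4}$ to which the Anomaly flow $$\partial_t(\Vert\Psi\Vert_{\omega_t}\omega_t^2)= i\partial\overline\partial\omega_t-\frac{\alpha'}{4}\mathrm{Tr}(Rm^\tau_t\wedge Rm^\tau_t)$$ starting at $\omega_0$ reduces. Then the sign of $K_1$ depends only on the complex structure $J$ on $G$. Moreover: (i) If $\omega_0$ is balanced, then $K_1>0$. (ii) If $\omega_0$ is locally conformally Kähler, then $K_1<0$. (iii) The metric $\omega_0$ is pluriclosed if and only if $K_1=0$.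
   Context: Notation: $\zeta^{i\bar j}=\zeta^i\wedge\overline{\zeta^j}$. $b_1=\dim H^1(\mathfrak g)$. "Non-parallelizable" means $(G,J)$ is not a complex Lie group. $\Psi=\zeta^1\wedge\zeta^2\wedge\zeta^3$. Write $2\omega_0=i(r_0^2\zeta^{1\bar1}+s_0^2\zeta^{2\bar2}+k_0^2\zeta^{3\bar3})+u_0\zeta^{1\bar2}-\bar u_0\zeta^{2\bar1}+v_0\zeta^{2\bar3}-\bar v_0\zeta^{3\bar2}+z_0\zeta^{1\bar3}-\bar z_0\zeta^{3\bar1}$; for $\omega=\frac i2\sum h_{j\bar l}\zeta^{j\bar l}$, $\Vert\Psi\Vert^2_\omega=8/\det(h_{j\bar l})$. The constant $K_1$ is explicitly $K_1(\omega_0)=\frac{c_1k_0^2}{8}(\rho+\lambda^2-2x)$, with $c_1=\Vert\Psi\Vert_{\omega_0}(r_0^2k_0^2-|z_0|^2)>0$. Balanced: $d(\omega^2)=0$. Locally conformally Kähler: $d\omega=\theta\wedge\omega$ with $\theta$ the closed Lee form. Pluriclosed: $\partial\overline\partial\omega=0$. ($Rm^\tau_t$ is the curvature of the Gauduchon connection of $\omega_t$ with parameter $\tau$, where $\tau=1$ is Chern and $\tau=-1$ is Strominger–Bismut; $\alpha'\in\mathbb R$.) *)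

theory Defs
  imports "HOL-Analysis.Analysis"
begin

text \<open>
  Left-invariant tensors on a Lie group are tensors on its Lie algebra, and the exterior derivative
  of left-invariant forms is the Chevalley--Eilenberg differential.  The Lie group therefore enters
  through its Lie algebra: a bracket on a real vector space \<open>'g\<close>.  (The class
  \<open>euclidean_space\<close> only supplies finite dimension; its inner product is never used.)
\<close>

definition lie_bracket :: "('g::euclidean_space \<Rightarrow> 'g \<Rightarrow> 'g) \<Rightarrow> bool" where
  "lie_bracket br \<longleftrightarrow> bilinear br \<and> (\<forall>X. br X X = 0) \<and>
     (\<forall>X Y Z. br X (br Y Z) + br Y (br Z X) + br Z (br X Y) = 0)"

definition two_step_nilpotent :: "('g::euclidean_space \<Rightarrow> 'g \<Rightarrow> 'g) \<Rightarrow> bool" where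
  "two_step_nilpotent br \<longleftrightarrow> lie_bracket br \<and>
     (\<exists>X Y. br X Y \<noteq> 0) \<and> (\<forall>X Y Z. br (br X Y) Z = 0)"

definition complex_structure ::
    "('g::euclidean_space \<Rightarrow> 'g \<Rightarrow> 'g) \<Rightarrow> ('g \<Rightarrow> 'g) \<Rightarrow> bool" where
  "complex_structure br J \<longleftrightarrow> linear J \<and> (\<forall>X. J (J X) = - X) \<and>
     (\<forall>X Y. br (J X) (J Y) - br X Y - J (br (J X) Y) - J (br X (J Y)) = 0)"

text \<open>\<open>(G, J)\<close> is a complex Lie group iff the bracket is complex bilinear.\<close>

definition complex_parallelizable ::
    "('g::euclidean_space \<Rightarrow> 'g \<Rightarrow> 'g) \<Rightarrow> ('g \<Rightarrow> 'g) \<Rightarrow> bool" where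
  "complex_parallelizable br J \<longleftrightarrow> (\<forall>X Y. br (J X) Y = J (br X Y))"


text \<open>
  A complex-valued form is a function on lists of vectors, vanishing on lists whose length is not
  its degree.  With this convention the operations below need no degree argument, and equality of
  forms is equality of functions.
\<close>

type_synonym 'g form = "'g list \<Rightarrow> complex"

definition forms :: "nat \<Rightarrow> 'g::euclidean_space form set" where
  "forms k = {\<alpha>. (\<forall>v. length v \<noteq> k \<longrightarrow> \<alpha> v = 0) \<and>
     (\<forall>v i. length v = k \<longrightarrow> i < k \<longrightarrow> linear (\<lambda>X. \<alpha> (v[i := X]))) \<and>
     (\<forall>v i j. length v = k \<longrightarrow> i < j \<longrightarrow> j < k \<longrightarrow> v ! i = v ! j \<longrightarrow> \<alpha> v = 0)}"

definition real_form :: "'g form \<Rightarrow> bool" where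
  "real_form \<alpha> \<longleftrightarrow> (\<forall>v. \<alpha> v \<in> \<real>)"

definition conj_form :: "'g form \<Rightarrow> 'g form" where
  "conj_form \<alpha> = (\<lambda>v. cnj (\<alpha> v))"

text \<open>
  Shuffle formula; the subset \<open>A\<close> is the set of positions fed to the first factor.  Normalisation:
  \<open>(\<alpha> \<and> \<beta>)(X, Y) = \<alpha>(X) \<beta>(Y) - \<alpha>(Y) \<beta>(X)\<close> for 1-forms.
\<close>

definition wedge :: "'g form \<Rightarrow> 'g form \<Rightarrow> 'g form"  (infixr "\<and>\<^sub>f" 75) where
  "wedge \<alpha> \<beta> = (\<lambda>v. \<Sum>A\<in>Pow {..<length v}.
     (-1) ^ card {(i, j). i \<in> A \<and> j \<notin> A \<and> j < i} * \<alpha> (nths v A) * \<beta> (nths v (- A)))"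

definition ext_d :: "('g \<Rightarrow> 'g \<Rightarrow> 'g) \<Rightarrow> 'g form \<Rightarrow> 'g form" where
  "ext_d br \<alpha> = (\<lambda>v. \<Sum>(i, j) | i < j \<and> j < length v.
     (-1) ^ (i + j) * \<alpha> (br (v ! i) (v ! j) # nths v (- {i, j})))"

text \<open>
  Projection to type \<open>(p, q)\<close>: insert \<open>\<pi>\<^sup>1\<^sup>,\<^sup>0 X = (X - \<i> J X) / 2\<close> in the positions of \<open>A\<close> and
  \<open>\<pi>\<^sup>0\<^sup>,\<^sup>1 X = (X + \<i> J X) / 2\<close> in the others, expand complex-multilinearly (\<open>B\<close> is the set of
  positions where the term with \<open>J\<close> is taken), and sum over all \<open>A\<close> with \<open>p\<close> elements.
\<close>

definition pq_part :: "('g \<Rightarrow> 'g) \<Rightarrow> nat \<Rightarrow> nat \<Rightarrow> 'g form \<Rightarrow> 'g form" where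
  "pq_part J p q \<alpha> = (\<lambda>v. if length v = p + q then
     \<Sum>A | A \<subseteq> {..<p + q} \<and> card A = p. \<Sum>B\<in>Pow {..<p + q}.
       (\<Prod>j\<in>B. if j \<in> A then - \<i> else \<i>) / 2 ^ (p + q) *
         \<alpha> (map (\<lambda>j. if j \<in> B then J (v ! j) else v ! j) [0..<p + q])
     else 0)"

definition pq_forms :: "('g::euclidean_space \<Rightarrow> 'g) \<Rightarrow> nat \<Rightarrow> nat \<Rightarrow> 'g form set" where
  "pq_forms J p q = {\<alpha> \<in> forms (p + q). pq_part J p q \<alpha> = \<alpha>}"

text \<open>On forms of type \<open>(p, q)\<close>, \<open>del\<close> and \<open>delbar\<close> are the parts of \<open>d\<close> of types \<open>(p + 1, q)\<close> and
  \<open>(p, q + 1)\<close>; they are extended additively.\<close>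

definition del :: "('g \<Rightarrow> 'g \<Rightarrow> 'g) \<Rightarrow> ('g \<Rightarrow> 'g) \<Rightarrow> 'g form \<Rightarrow> 'g form" where
  "del br J \<alpha> = (\<lambda>v. \<Sum>(p, q) | p + q + 1 = length v.
     pq_part J (p + 1) q (ext_d br (pq_part J p q \<alpha>)) v)"

definition delbar :: "('g \<Rightarrow> 'g \<Rightarrow> 'g) \<Rightarrow> ('g \<Rightarrow> 'g) \<Rightarrow> 'g form \<Rightarrow> 'g form" where
  "delbar br J \<alpha> = (\<lambda>v. \<Sum>(p, q) | p + q + 1 = length v.
     pq_part J p (q + 1) (ext_d br (pq_part J p q \<alpha>)) v)"

text \<open>\<open>dim H\<^sup>1(\<gg>)\<close>: the differential of 0-forms is zero, so this is the dimension of the space of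
  closed real 1-forms.\<close>

definition b1 :: "('g::euclidean_space \<Rightarrow> 'g \<Rightarrow> 'g) \<Rightarrow> nat" where
  "b1 br = dim {a :: 'g \<Rightarrow>\<^sub>L real.
     ext_d br (\<lambda>v. if length v = 1 then of_real (blinfun_apply a (hd v)) else 0) = (\<lambda>_. 0)}"

definition coframe10 :: "('g::euclidean_space \<Rightarrow> 'g) \<Rightarrow> (3 \<Rightarrow> 'g form) \<Rightarrow> bool" where
  "coframe10 J \<zeta> \<longleftrightarrow> (\<forall>j. \<zeta> j \<in> pq_forms J 1 0) \<and>
     (\<forall>\<alpha>\<in>pq_forms J 1 0. \<exists>!c :: complex^3. \<alpha> = (\<lambda>v. \<Sum>j\<in>UNIV. c $ j * \<zeta> j v))"

definition adapted_coframe ::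
    "('g::euclidean_space \<Rightarrow> 'g \<Rightarrow> 'g) \<Rightarrow> ('g \<Rightarrow> 'g) \<Rightarrow> (3 \<Rightarrow> 'g form) \<Rightarrow>
     real \<Rightarrow> real \<Rightarrow> real \<Rightarrow> real \<Rightarrow> bool" where
  "adapted_coframe br J \<zeta> \<rho> l x y \<longleftrightarrow> coframe10 J \<zeta> \<and> \<rho> \<in> {0, 1} \<and> l \<ge> 0 \<and>
     ext_d br (\<zeta> 1) = (\<lambda>_. 0) \<and> ext_d br (\<zeta> 2) = (\<lambda>_. 0) \<and>
     ext_d br (\<zeta> 3) = (\<lambda>v. of_real \<rho> * (\<zeta> 1 \<and>\<^sub>f \<zeta> 2) v + (\<zeta> 1 \<and>\<^sub>f conj_form (\<zeta> 1)) v
       + of_real l * (\<zeta> 1 \<and>\<^sub>f conj_form (\<zeta> 2)) v + Complex x y * (\<zeta> 2 \<and>\<^sub>f conj_form (\<zeta> 2)) v)"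

text \<open>A Hermitian metric is given by its fundamental form \<open>\<omega>\<close>; the Riemannian metric is
  \<open>g(X, Y) = \<omega>(X, J Y)\<close>.\<close>

definition hermitian_metric :: "('g::euclidean_space \<Rightarrow> 'g) \<Rightarrow> 'g form \<Rightarrow> bool" where
  "hermitian_metric J \<omega> \<longleftrightarrow> \<omega> \<in> forms 2 \<and> real_form \<omega> \<and>
     (\<forall>X Y. \<omega> [J X, J Y] = \<omega> [X, Y]) \<and> (\<forall>X. X \<noteq> 0 \<longrightarrow> Re (\<omega> [X, J X]) > 0)"

definition balanced :: "('g \<Rightarrow> 'g \<Rightarrow> 'g) \<Rightarrow> 'g form \<Rightarrow> bool" where
  "balanced br \<omega> \<longleftrightarrow> ext_d br (\<omega> \<and>\<^sub>f \<omega>) = (\<lambda>_. 0)"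

definition locally_conformally_kaehler ::
    "('g::euclidean_space \<Rightarrow> 'g \<Rightarrow> 'g) \<Rightarrow> 'g form \<Rightarrow> bool" where
  "locally_conformally_kaehler br \<omega> \<longleftrightarrow> (\<exists>\<theta>\<in>forms 1. real_form \<theta> \<and>
     ext_d br \<theta> = (\<lambda>_. 0) \<and> ext_d br \<omega> = \<theta> \<and>\<^sub>f \<omega>)"

definition pluriclosed :: "('g \<Rightarrow> 'g \<Rightarrow> 'g) \<Rightarrow> ('g \<Rightarrow> 'g) \<Rightarrow> 'g form \<Rightarrow> bool" where
  "pluriclosed br J \<omega> \<longleftrightarrow> del br J (delbar br J \<omega>) = (\<lambda>_. 0)"

definition metric_coefficients ::
    "(3 \<Rightarrow> 'g form) \<Rightarrow> 'g form \<Rightarrow>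
     real \<Rightarrow> real \<Rightarrow> real \<Rightarrow> complex \<Rightarrow> complex \<Rightarrow> complex \<Rightarrow> bool" where
  "metric_coefficients \<zeta> \<omega> r s k u v z \<longleftrightarrow>
     (let e = (\<lambda>j l. \<zeta> j \<and>\<^sub>f conj_form (\<zeta> l)) in
      (\<forall>w. 2 * \<omega> w =
         \<i> * (of_real (r\<^sup>2) * e 1 1 w + of_real (s\<^sup>2) * e 2 2 w + of_real (k\<^sup>2) * e 3 3 w)
         + u * e 1 2 w - cnj u * e 2 1 w
         + v * e 2 3 w - cnj v * e 3 2 w
         + z * e 1 3 w - cnj z * e 3 1 w))"

text \<open>The Hermitian matrix \<open>h\<close> with \<open>\<omega> = (\<i>/2) \<Sum> h\<^sub>j\<^sub>l \<zeta>\<^sup>j \<and> conj \<zeta>\<^sup>l\<close>.\<close>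

definition metric_matrix ::
    "real \<Rightarrow> real \<Rightarrow> real \<Rightarrow> complex \<Rightarrow> complex \<Rightarrow> complex \<Rightarrow> complex^3^3" where
  "metric_matrix r s k u v z = vector [
     vector [of_real (r\<^sup>2), - \<i> * u, - \<i> * z],
     vector [\<i> * cnj u, of_real (s\<^sup>2), - \<i> * v],
     vector [\<i> * cnj z, \<i> * cnj v, of_real (k\<^sup>2)]]"

text \<open>The norm of \<open>\<Psi> = \<zeta>\<^sup>1 \<and> \<zeta>\<^sup>2 \<and> \<zeta>\<^sup>3\<close>: \<open>\<parallel>\<Psi>\<parallel>\<^sup>2 = 8 / det h\<close> (\<open>det h\<close> is real, \<open>h\<close> being Hermitian).\<close>

definition norm_Psi ::
    "real \<Rightarrow> real \<Rightarrow> real \<Rightarrow> complex \<Rightarrow> complex \<Rightarrow> complex \<Rightarrow> real" where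
  "norm_Psi r s k u v z = sqrt (8 / Re (det (metric_matrix r s k u v z)))"

text \<open>
  \<open>K\<^sub>1(\<omega>)\<close>, the constant in the equation \<open>d/dt r(t)\<^sup>2 = K\<^sub>1 + K\<^sub>2 / r(t)\<^sup>4\<close> to which the Anomaly flow
  starting at \<open>\<omega>\<close> reduces, as an explicit function of the coefficients of \<open>\<omega>\<close>.  It is the contribution of the
  pluriclosedness defect \<open>\<i> \<partial> \<partial>\<close>-bar \<open>\<omega>\<close>; the slope parameter and the curvature term of the flow
  enter \<open>K\<^sub>2\<close> only.
\<close>

definition K1 ::
    "real \<Rightarrow> real \<Rightarrow> real \<Rightarrow>
     real \<Rightarrow> real \<Rightarrow> real \<Rightarrow> complex \<Rightarrow> complex \<Rightarrow> complex \<Rightarrow> real" where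
  "K1 \<rho> l x r s k u v z =
     (let c1 = norm_Psi r s k u v z * (r\<^sup>2 * k\<^sup>2 - (cmod z)\<^sup>2)
      in c1 * k\<^sup>2 / 8 * (\<rho> + l\<^sup>2 - 2 * x))"

end

theory Submission
  imports Defs
begin

text \<open>
  Put \<open>E = \<rho> + l\<^sup>2 - 2 x\<close>.  Positivity of the Hermitian matrix makes \<open>K\<^sub>1\<close> a positive multiple of \<open>E\<close>,
  and a computation gives
  \<open>(\<partial> \<partial>-bar \<omega>)(X, J X, Y, J Y) = - \<i> \<kappa> E \<bar>\<zeta>\<^sup>1 X \<zeta>\<^sup>2 Y - \<zeta>\<^sup>1 Y \<zeta>\<^sup>2 X\<bar>\<^sup>2\<close> with \<open>\<kappa> > 0\<close>.  The left-hand side does not see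
  the coframe, so the sign of \<open>E\<close> is an invariant of \<open>J\<close>, and \<open>\<omega>\<close> is pluriclosed iff \<open>E = 0\<close>.
  For the other two claims, take an \<open>\<omega>\<close>-orthogonal complex frame \<open>Y\<^sub>1, Y\<^sub>2, W\<close> with \<open>W\<close> in the centre and
  \<open>m\<^sub>i = \<omega>(Y\<^sub>i, J Y\<^sub>i)\<close>.  Balanced means \<open>m\<^sub>2 [Y\<^sub>1, J Y\<^sub>1] + m\<^sub>1 [Y\<^sub>2, J Y\<^sub>2] = 0\<close>, which forces \<open>2 x < l\<^sup>2\<close>.  Locally
  conformally Kaehler means that \<open>[X, Y] = \<omega>(X, Y) C\<close> on the complement of the centre for a fixed vector \<open>C\<close>;
  then \<open>\<rho> = l = 0\<close> and \<open>x > 0\<close>.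
\<close>

section \<open>Wedge products, differentials and type projections in low degree\<close>

text \<open>Counting inversions position by position turns the exponent of the sign into a sum that
  can be evaluated on explicit sets.\<close>

lemma card_inversions:
  assumes "finite (A :: nat set)"
  shows "card {(i, j). i \<in> A \<and> j \<notin> A \<and> j < i} = (\<Sum>i\<in>A. card ({..<i} - A))"
proof -
  have "{(i, j). i \<in> A \<and> j \<notin> A \<and> j < i} = Sigma A (\<lambda>i. {..<i} - A)" by auto
  then show ?thesis using assms by simp
qed

lemma wedge_alt:
  "(\<alpha> \<and>\<^sub>f \<beta>) v = (\<Sum>A\<in>Pow {..<length v}.
     (-1) ^ (\<Sum>i\<in>A. card ({..<i} - A)) * \<alpha> (nths v A) * \<beta> (nths v (- A)))"
  unfolding wedge_def by (intro sum.cong refl) (simp add: card_inversions finite_subset)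

text \<open>Subsets are split by whether they contain \<open>n\<close>. Repeated rewriting unrolls a
  shuffle sum over a fixed number of positions.\<close>

lemma sum_Pow_lessThan_Suc:
  "(\<Sum>A\<in>Pow {..<Suc n}. f A) = (\<Sum>A\<in>Pow {..<n}. f A + f (insert n A))"
proof -
  have "Pow {..<n} \<inter> insert n ` Pow {..<n} = {}" "inj_on (insert n) (Pow {..<n})"
    by (auto simp: inj_on_def)
  then show ?thesis
    by (simp add: lessThan_Suc Pow_insert sum.union_disjoint sum.reindex sum.distrib)
qed

text \<open>Pascal's recursion for subsets of fixed size, used to unroll the sum over
  \<open>A\<close> in \<open>pq_part\<close>.\<close>

lemma sum_subsets_card_Suc:
  fixes n :: nat
  shows "(\<Sum>A | A \<subseteq> {..<Suc n} \<and> card A = Suc p. f A) =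
   (\<Sum>A | A \<subseteq> {..<n} \<and> card A = Suc p. f A) + (\<Sum>A | A \<subseteq> {..<n} \<and> card A = p. f (insert n A))"
proof -
  have card: "card (insert n A) = Suc (card A)" if "A \<subseteq> {..<n}" for A
    using that finite_subset[OF that] by (intro card_insert_disjoint) auto
  have "(\<Sum>A | A \<subseteq> {..<m} \<and> card A = q. g A) = (\<Sum>A\<in>Pow {..<m}. if card A = q then g A else 0)"
    for m :: nat and q and g :: "nat set \<Rightarrow> 'a"
    by (subst sum.inter_filter[symmetric]) (simp_all add: Pow_def)
  moreover have "(\<Sum>A\<in>Pow {..<n}. if card (insert n A) = Suc p then f (insert n A) else 0) =
      (\<Sum>A\<in>Pow {..<n}. if card A = p then f (insert n A) else 0)"
    by (rule sum.cong) (auto simp: card)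
  ultimately show ?thesis
    by (simp add: sum_Pow_lessThan_Suc sum.distrib)
qed

lemma sum_subsets_card_0:
  fixes n :: nat
  shows "(\<Sum>A | A \<subseteq> {..<n} \<and> card A = 0. f A) = f {}"
proof -
  have "{A. A \<subseteq> {..<n} \<and> card A = 0} = {{}}"
    using finite_subset[OF _ finite_lessThan[of n]] by (auto simp: card_eq_0_iff)
  then show ?thesis by simp
qed

lemma empty_subset_card:
  "{A. A = {} \<and> card A = 0} = {{}}" "{A. A = {} \<and> card A = Suc p} = {}"
  by auto

lemmas wedge_expand = wedge_alt sum_Pow_lessThan_Suc nths_Cons eval_nat_numeral

lemma wedge_1_1:
  assumes "\<And>v. length v \<noteq> 1 \<Longrightarrow> \<alpha> v = 0" "\<And>v. length v \<noteq> 1 \<Longrightarrow> \<beta> v = 0"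
  shows "(\<alpha> \<and>\<^sub>f \<beta>) [X, Y] = \<alpha> [X] * \<beta> [Y] - \<alpha> [Y] * \<beta> [X]"
  by (simp add: wedge_expand assms)

lemma wedge_1_2:
  assumes "\<And>v. length v \<noteq> 1 \<Longrightarrow> \<alpha> v = 0" "\<And>v. length v \<noteq> 2 \<Longrightarrow> \<beta> v = 0"
  shows "(\<alpha> \<and>\<^sub>f \<beta>) [X, Y, Z] = \<alpha> [X] * \<beta> [Y, Z] - \<alpha> [Y] * \<beta> [X, Z] + \<alpha> [Z] * \<beta> [X, Y]"
  by (simp add: wedge_expand assms)

text \<open>The six shuffles coincide in pairs because 2-forms commute, hence the factor 2.\<close>

lemma wedge_2_2:
  assumes "\<And>v. length v \<noteq> 2 \<Longrightarrow> \<alpha> v = 0"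
  shows "(\<alpha> \<and>\<^sub>f \<alpha>) [X, Y, Z, W] =
    2 * (\<alpha> [X, Y] * \<alpha> [Z, W] - \<alpha> [X, Z] * \<alpha> [Y, W] + \<alpha> [X, W] * \<alpha> [Y, Z])"
  by (simp add: wedge_expand assms)

text \<open>Running over the larger index first gives nested initial segments, which unfold on lists
  of known length.\<close>

lemma ext_d_alt:
  "ext_d br \<alpha> v = (\<Sum>j<length v. \<Sum>i<j.
     (-1) ^ (i + j) * \<alpha> (br (v ! i) (v ! j) # nths v (- {i, j})))"
proof -
  let ?f = "\<lambda>j i. (-1) ^ (i + j) * \<alpha> (br (v ! i) (v ! j) # nths v (- {i, j}))"
  have "(\<Sum>j<length v. \<Sum>i<j. ?f j i) = (\<Sum>(j, i)\<in>Sigma {..<length v} lessThan. ?f j i)"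
    by (rule sum.Sigma) auto
  also have "\<dots> = (\<Sum>(i, j) | i < j \<and> j < length v. ?f j i)"
    by (rule sum.reindex_bij_witness[where i = prod.swap and j = prod.swap]) auto
  finally show ?thesis by (simp add: ext_d_def)
qed

lemma ext_d_2: "ext_d br \<alpha> [X, Y] = - \<alpha> [br X Y]"
  by (simp add: ext_d_alt nths_Cons eval_nat_numeral)

lemma ext_d_3: "ext_d br \<alpha> [X, Y, Z] = - \<alpha> [br X Y, Z] + \<alpha> [br X Z, Y] - \<alpha> [br Y Z, X]"
  by (simp add: ext_d_alt nths_Cons eval_nat_numeral)

lemma ext_d_4: "ext_d br \<alpha> [X, Y, Z, W] =
   - \<alpha> [br X Y, Z, W] + \<alpha> [br X Z, Y, W] - \<alpha> [br X W, Y, Z]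
   - \<alpha> [br Y Z, X, W] + \<alpha> [br Y W, X, Z] - \<alpha> [br Z W, X, Y]"
  by (simp add: ext_d_alt nths_Cons eval_nat_numeral)

lemma ext_d_5: "ext_d br \<alpha> [X, Y, Z, W, U] =
   - \<alpha> [br X Y, Z, W, U] + \<alpha> [br X Z, Y, W, U] - \<alpha> [br X W, Y, Z, U] + \<alpha> [br X U, Y, Z, W]
   - \<alpha> [br Y Z, X, W, U] + \<alpha> [br Y W, X, Z, U] - \<alpha> [br Y U, X, Z, W]
   - \<alpha> [br Z W, X, Y, U] + \<alpha> [br Z U, X, Y, W] - \<alpha> [br W U, X, Y, Z]"
  by (simp add: ext_d_alt nths_Cons eval_nat_numeral)

section \<open>Type projections of 2-, 3- and 4-forms\<close>

lemmas pq_part_expand = pq_part_def sum_Pow_lessThan_Suc sum_subsets_card_Suc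
  sum_subsets_card_0 empty_subset_card eval_nat_numeral

lemma pq_part_2:
  "pq_part J 1 1 \<alpha> [X, Y] = (\<alpha> [X, Y] + \<alpha> [J X, J Y]) / 2"
  "pq_part J 2 0 \<alpha> [X, Y] = (\<alpha> [X, Y] - \<i> * \<alpha> [J X, Y] - \<i> * \<alpha> [X, J Y] - \<alpha> [J X, J Y]) / 4"
  "pq_part J 0 2 \<alpha> [X, Y] = (\<alpha> [X, Y] + \<i> * \<alpha> [J X, Y] + \<i> * \<alpha> [X, J Y] - \<alpha> [J X, J Y]) / 4"
  by (simp_all add: pq_part_expand)

lemma pq_part_3:
  "pq_part J 3 0 \<alpha> [X, Y, Z] = (\<alpha> [X, Y, Z]
    - \<i> * (\<alpha> [J X, Y, Z] + \<alpha> [X, J Y, Z] + \<alpha> [X, Y, J Z])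
    - (\<alpha> [J X, J Y, Z] + \<alpha> [J X, Y, J Z] + \<alpha> [X, J Y, J Z]) + \<i> * \<alpha> [J X, J Y, J Z]) / 8"
  "pq_part J 2 1 \<alpha> [X, Y, Z] = (3 * \<alpha> [X, Y, Z]
    - \<i> * (\<alpha> [J X, Y, Z] + \<alpha> [X, J Y, Z] + \<alpha> [X, Y, J Z])
    + (\<alpha> [J X, J Y, Z] + \<alpha> [J X, Y, J Z] + \<alpha> [X, J Y, J Z]) - 3 * \<i> * \<alpha> [J X, J Y, J Z]) / 8"
  "pq_part J 1 2 \<alpha> [X, Y, Z] = (3 * \<alpha> [X, Y, Z]
    + \<i> * (\<alpha> [J X, Y, Z] + \<alpha> [X, J Y, Z] + \<alpha> [X, Y, J Z])
    + (\<alpha> [J X, J Y, Z] + \<alpha> [J X, Y, J Z] + \<alpha> [X, J Y, J Z]) + 3 * \<i> * \<alpha> [J X, J Y, J Z]) / 8"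
  "pq_part J 0 3 \<alpha> [X, Y, Z] = (\<alpha> [X, Y, Z]
    + \<i> * (\<alpha> [J X, Y, Z] + \<alpha> [X, J Y, Z] + \<alpha> [X, Y, J Z])
    - (\<alpha> [J X, J Y, Z] + \<alpha> [J X, Y, J Z] + \<alpha> [X, J Y, J Z]) - \<i> * \<alpha> [J X, J Y, J Z]) / 8"
  by (simp_all add: pq_part_expand distrib_left)

text \<open>Terms with an odd number of \<open>J\<close> cancel: exchanging \<open>A\<close> with
  its complement changes their sign.\<close>

lemma pq_part_2_2:
  "pq_part J 2 2 \<alpha> [X, Y, Z, W] = (3 * \<alpha> [X, Y, Z, W]
    + (\<alpha> [J X, J Y, Z, W] + \<alpha> [J X, Y, J Z, W] + \<alpha> [J X, Y, Z, J W]
     + \<alpha> [X, J Y, J Z, W] + \<alpha> [X, J Y, Z, J W] + \<alpha> [X, Y, J Z, J W])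
    + 3 * \<alpha> [J X, J Y, J Z, J W]) / 8"
  by (simp add: pq_part_expand)

section \<open>Adapted coframes\<close>

lemma pq_part_1:
  "pq_part J 1 0 \<alpha> [X] = (\<alpha> [X] - \<i> * \<alpha> [J X]) / 2"
  by (simp add: pq_part_expand)

lemma linear_complex_simps:
  assumes "linear (f :: 'a::real_vector \<Rightarrow> complex)"
  shows "f (X + Y) = f X + f Y" "f (X - Y) = f X - f Y" "f (- X) = - f X"
    "f (r *\<^sub>R X) = of_real r * f X" "f 0 = 0"
  using assms by (simp_all add: linear_add linear_diff linear_neg linear_cmul linear_0 scaleR_conv_of_real)

locale adapted_coframe_algebra =
  fixes br :: "'g::euclidean_space \<Rightarrow> 'g \<Rightarrow> 'g" and J :: "'g \<Rightarrow> 'g"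
    and \<zeta> :: "3 \<Rightarrow> 'g form" and \<rho> l x y :: real
  assumes lie: "lie_bracket br" and linear_J: "linear J" and J_J [simp]: "\<And>X. J (J X) = - X"
    and coframe: "adapted_coframe br J \<zeta> \<rho> l x y"
begin

lemma J_simps: "J (X + Y) = J X + J Y" "J (X - Y) = J X - J Y" "J (- X) = - J X" "J (r *\<^sub>R X) = r *\<^sub>R J X"
    "J 0 = 0"
  using linear_J by (simp_all add: linear_add linear_diff linear_neg linear_cmul linear_0)

lemma zeta_pq: "\<zeta> j \<in> pq_forms J 1 0"
  using coframe by (simp add: adapted_coframe_def coframe10_def)

lemma zeta_length: "length v \<noteq> 1 \<Longrightarrow> \<zeta> j v = 0"
  using zeta_pq[of j] by (simp add: pq_forms_def forms_def)

lemma linear_zeta: "linear (\<lambda>X. \<zeta> j [X])"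
proof -
  have "\<zeta> j \<in> forms 1"
    using zeta_pq[of j] by (simp add: pq_forms_def)
  then have "\<And>v i. length v = 1 \<Longrightarrow> i < 1 \<Longrightarrow> linear (\<lambda>X. \<zeta> j (v[i := X]))"
    unfolding forms_def by blast
  from this[of "[0]" 0] show ?thesis by simp
qed

lemmas zeta_simps = linear_complex_simps[OF linear_zeta]

text \<open>Type (1,0) means being fixed by the projection, and solving that equation gives complex
  linearity.\<close>

lemma zeta_J [simp]: "\<zeta> j [J X] = \<i> * \<zeta> j [X]"
proof -
  have "\<zeta> j [X] = (\<zeta> j [X] - \<i> * \<zeta> j [J X]) / 2"
    using zeta_pq[of j] pq_part_1[of J "\<zeta> j" X] by (simp add: pq_forms_def)
  then have "\<zeta> j [X] = - \<i> * \<zeta> j [J X]" by (simp add: eq_neg_iff_add_eq_0)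
  then show ?thesis by simp
qed

text \<open>A closed 1-form annihilates commutators.\<close>

lemma zeta_br [simp]: "\<zeta> 1 [br X Y] = 0" "\<zeta> 2 [br X Y] = 0"
proof -
  have "ext_d br (\<zeta> 1) [X, Y] = 0" "ext_d br (\<zeta> 2) [X, Y] = 0"
    using coframe by (simp_all add: adapted_coframe_def)
  then show "\<zeta> 1 [br X Y] = 0" "\<zeta> 2 [br X Y] = 0" by (simp_all add: ext_d_2)
qed

lemma zeta_3_br: "\<zeta> 3 [br X Y] =
  - (\<rho> * (\<zeta> 1 [X] * \<zeta> 2 [Y] - \<zeta> 1 [Y] * \<zeta> 2 [X])
   + (\<zeta> 1 [X] * cnj (\<zeta> 1 [Y]) - \<zeta> 1 [Y] * cnj (\<zeta> 1 [X]))
   + l * (\<zeta> 1 [X] * cnj (\<zeta> 2 [Y]) - \<zeta> 1 [Y] * cnj (\<zeta> 2 [X]))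
   + Complex x y * (\<zeta> 2 [X] * cnj (\<zeta> 2 [Y]) - \<zeta> 2 [Y] * cnj (\<zeta> 2 [X])))"
proof -
  have conj: "length v \<noteq> 1 \<Longrightarrow> conj_form (\<zeta> j) v = 0" for v j
    by (simp add: conj_form_def zeta_length)
  have w: "(\<zeta> i \<and>\<^sub>f \<zeta> j) [X, Y] = \<zeta> i [X] * \<zeta> j [Y] - \<zeta> i [Y] * \<zeta> j [X]"
    "(\<zeta> i \<and>\<^sub>f conj_form (\<zeta> j)) [X, Y]
      = \<zeta> i [X] * conj_form (\<zeta> j) [Y] - \<zeta> i [Y] * conj_form (\<zeta> j) [X]" for i j
    by (intro wedge_1_1 zeta_length conj; assumption)+
  have "ext_d br (\<zeta> 3) = (\<lambda>v. of_real \<rho> * (\<zeta> 1 \<and>\<^sub>f \<zeta> 2) v + (\<zeta> 1 \<and>\<^sub>f conj_form (\<zeta> 1)) v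
       + of_real l * (\<zeta> 1 \<and>\<^sub>f conj_form (\<zeta> 2)) v + Complex x y * (\<zeta> 2 \<and>\<^sub>f conj_form (\<zeta> 2)) v)"
    using coframe by (simp add: adapted_coframe_def)
  from fun_cong[OF this, of "[X, Y]"] show ?thesis
    unfolding ext_d_2 w unfolding conj_form_def by (rule minus_equation_iff[THEN iffD1, symmetric])
qed

text \<open>The coframe spans all (1,0)-forms, so it suffices to find one (1,0)-form that does not
  vanish at a given nonzero \<open>X\<close>.\<close>

lemma zeta_eq_0_iff: "(\<forall>j. \<zeta> j [X] = 0) \<longleftrightarrow> X = 0"
proof
  assume zero: "\<forall>j. \<zeta> j [X] = 0"
  \<comment> \<open>Twice the (1,0)-part of the functional \<open>Y \<mapsto> X \<bullet> Y\<close>;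
    its real part at \<open>X\<close> is the squared length of \<open>X\<close>.\<close>
  define \<alpha> :: "'g form" where
    "\<alpha> v = (if length v = 1 then of_real (X \<bullet> hd v) - \<i> * of_real (X \<bullet> J (hd v)) else 0)" for v
  have "linear (\<lambda>Y. \<alpha> [Y])"
    by (rule linearI)
      (simp_all add: \<alpha>_def J_simps inner_add_right algebra_simps scaleR_conv_of_real)
  then have "\<alpha> \<in> forms 1"
    by (auto simp: forms_def \<alpha>_def length_Suc_conv)
  moreover have "pq_part J 1 0 \<alpha> v = \<alpha> v" for v
  proof (cases "length v = 1")
    case True
    then obtain Y where "v = [Y]" by (auto simp: length_Suc_conv)
    then show ?thesis by (simp add: pq_part_1[unfolded One_nat_def] \<alpha>_def field_simps)
  next
    case False
    then show ?thesis by (simp add: pq_part_def \<alpha>_def)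
  qed
  ultimately have "\<alpha> \<in> pq_forms J 1 0" by (auto simp: pq_forms_def)
  then obtain c :: "complex^3" where "\<alpha> = (\<lambda>v. \<Sum>j\<in>UNIV. c $ j * \<zeta> j v)"
    using coframe unfolding adapted_coframe_def coframe10_def by blast
  then have "\<alpha> [X] = 0" by (simp add: zero)
  then have "Re (\<alpha> [X]) = 0" by simp
  then show "X = 0" by (simp add: \<alpha>_def)
qed (simp add: zeta_simps)

lemma zeta_eqI: "\<zeta> 1 [X] = \<zeta> 1 [Y] \<Longrightarrow> \<zeta> 2 [X] = \<zeta> 2 [Y] \<Longrightarrow> \<zeta> 3 [X] = \<zeta> 3 [Y] \<Longrightarrow> X = Y"
  using zeta_eq_0_iff[of "X - Y"] by (simp add: zeta_simps forall_3)

text \<open>This is uniqueness of the coefficients for the zero form.\<close>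

lemma zeta_independent:
  assumes "\<And>X. (\<Sum>j\<in>UNIV. c $ j * \<zeta> j [X]) = 0"
  shows "c = (0 :: complex^3)"
proof -
  let ?Z = "\<lambda>_ :: 'g list. 0 :: complex"
  have "?Z \<in> forms 1"
    by (auto simp: forms_def linear_iff)
  then have "?Z \<in> pq_forms J 1 0"
    by (simp add: pq_forms_def pq_part_def fun_eq_iff)
  then have "\<exists>!c :: complex^3. ?Z = (\<lambda>v. \<Sum>j\<in>UNIV. c $ j * \<zeta> j v)"
    using coframe unfolding adapted_coframe_def coframe10_def by blast
  moreover have "(\<Sum>j\<in>UNIV. c $ j * \<zeta> j v) = 0" for v
  proof (cases "length v = 1")
    case True
    then obtain Y where "v = [Y]" by (auto simp: length_Suc_conv)
    then show ?thesis by (simp add: assms)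
  qed (simp add: zeta_length)
  then have "?Z = (\<lambda>v. \<Sum>j\<in>UNIV. c $ j * \<zeta> j v)" by simp
  moreover have "?Z = (\<lambda>v. \<Sum>j\<in>UNIV. (0 :: complex^3) $ j * \<zeta> j v)" by simp
  ultimately show ?thesis by blast
qed

text \<open>The image of \<open>\<gg>\<close> in \<open>\<complex>\<^sup>3\<close> is stable under \<open>\<i>\<close>, so a real functional vanishing on it is the
  real part of a complex one.\<close>

lemma zeta_surj:
  obtains X where "\<zeta> 1 [X] = a" "\<zeta> 2 [X] = b" "\<zeta> 3 [X] = c"
proof -
  define F where "F X = (\<chi> j. \<zeta> j [X])" for X
  have F: "linear F"
    by (rule linearI) (simp_all add: F_def vec_eq_iff zeta_simps scaleR_conv_of_real[where 'a = complex])
  have "span (range F) = UNIV"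
  proof (rule ccontr)
    assume "span (range F) \<noteq> UNIV"
    then obtain a where a: "a \<noteq> 0" "\<And>v. v \<in> span (range F) \<Longrightarrow> a \<bullet> v = 0"
      using span_not_UNIV_orthogonal by blast
    \<comment> \<open>The conjugate appears because the real inner product of complex numbers
      \<open>a\<close> and \<open>w\<close> is \<open>Re (cnj a * w)\<close>.\<close>
    define c :: "complex^3" where "c = (\<chi> j. cnj (a $ j))"
    have re: "Re (\<Sum>j\<in>UNIV. c $ j * \<zeta> j [X]) = 0" for X
      using a(2)[OF span_base, of "F X"]
      by (simp add: c_def F_def inner_vec_def inner_complex_def)
    have "(\<Sum>j\<in>UNIV. c $ j * \<zeta> j [X]) = 0" for X
    proof (rule complex_eqI)
      have "(\<Sum>j\<in>UNIV. c $ j * \<zeta> j [J X]) = \<i> * (\<Sum>j\<in>UNIV. c $ j * \<zeta> j [X])"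
        by (simp add: sum_distrib_left algebra_simps)
      then show "Im (\<Sum>j\<in>UNIV. c $ j * \<zeta> j [X]) = Im 0"
        using re[of "J X"] by simp
    qed (use re in simp)
    then have "c = 0" by (rule zeta_independent)
    then show False using a(1) by (simp add: c_def vec_eq_iff)
  qed
  moreover have "span (range F) = range F"
    using linear_subspace_image[OF F subspace_UNIV] by (simp add: span_eq_iff)
  ultimately have "vector [a, b, c] \<in> range F" by simp
  then obtain X where "F X = vector [a, b, c]" by auto
  then have "F X $ 1 = a" "F X $ 2 = b" "F X $ 3 = c" by (simp_all add: vector_3)
  then show ?thesis using that[of X] by (simp add: F_def)
qed

text \<open>All of \<open>\<zeta> j [br C X]\<close> are determined by the values of
  \<open>\<zeta> 1\<close> and \<open>\<zeta> 2\<close>, so their common kernel is central.\<close>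

lemma br_central:
  assumes "\<zeta> 1 [C] = 0" "\<zeta> 2 [C] = 0"
  shows "br C X = 0" "br X C = 0"
  by (rule zeta_eqI; simp add: zeta_3_br assms zeta_simps)+

end

section \<open>Balanced and locally conformally Kaehler metrics\<close>

text \<open>Instantiated twice with the same \<open>br\<close>, \<open>J\<close> and
  \<open>\<omega>\<close> but different coframes when the sign is compared between coframes.\<close>

locale adapted_coframe_metric = adapted_coframe_algebra br J \<zeta> \<rho> l x y
  for br :: "'g::euclidean_space \<Rightarrow> 'g \<Rightarrow> 'g" and J \<zeta> \<rho> l x y +
  fixes \<omega> :: "'g form"
  assumes metric: "hermitian_metric J \<omega>"
begin

section \<open>Linear algebra of the fundamental form\<close>

lemma omega_forms: "\<omega> \<in> forms 2"
  using metric by (simp add: hermitian_metric_def)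

lemma omega_length: "length v \<noteq> 2 \<Longrightarrow> \<omega> v = 0"
  using omega_forms by (simp add: forms_def)

lemma linear_omega: "linear (\<lambda>X. \<omega> [X, Y])" "linear (\<lambda>X. \<omega> [Y, X])"
proof -
  have *: "\<And>v i. length v = 2 \<Longrightarrow> i < 2 \<Longrightarrow> linear (\<lambda>X. \<omega> (v[i := X]))"
    using omega_forms unfolding forms_def by blast
  show "linear (\<lambda>X. \<omega> [X, Y])" "linear (\<lambda>X. \<omega> [Y, X])"
    using *[of "[Y, Y]" 0] *[of "[Y, Y]" 1] by simp_all
qed

lemmas omega_simps = linear_complex_simps[OF linear_omega(1)] linear_complex_simps[OF linear_omega(2)]

lemma omega_self [simp]: "\<omega> [X, X] = 0"
proof -
  have "\<And>v i j. length v = 2 \<Longrightarrow> i < j \<Longrightarrow> j < 2 \<Longrightarrow> v ! i = v ! j \<Longrightarrow> \<omega> v = 0"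
    using omega_forms unfolding forms_def by blast
  from this[of "[X, X]" 0 1] show ?thesis by simp
qed

lemma omega_swap: "\<omega> [Y, X] = - \<omega> [X, Y]"
  using omega_self[of "X + Y"] by (simp add: omega_simps del: omega_self) (simp add: eq_neg_iff_add_eq_0 add.commute)

lemma omega_wedge_omega:
  "(\<omega> \<and>\<^sub>f \<omega>) [X, Y, Z, W] =
    2 * (\<omega> [X, Y] * \<omega> [Z, W] - \<omega> [X, Z] * \<omega> [Y, W] + \<omega> [X, W] * \<omega> [Y, Z])"
  by (rule wedge_2_2) (rule omega_length)

lemma omega_J_J [simp]: "\<omega> [J X, J Y] = \<omega> [X, Y]"
  using metric by (simp add: hermitian_metric_def)

lemma omega_J_left: "\<omega> [J X, Y] = - \<omega> [X, J Y]"
  using omega_J_J[of X "J Y"] by (simp add: omega_simps del: omega_J_J) (metis minus_minus)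

lemma omega_real: "\<omega> v = of_real (Re (\<omega> v))"
  using metric by (metis hermitian_metric_def real_form_def of_real_Re)

lemma omega_pos: "X \<noteq> 0 \<Longrightarrow> Re (\<omega> [X, J X]) > 0"
  using metric by (simp add: hermitian_metric_def)

text \<open>Orthogonal projection off the complex line through \<open>W\<close>, possible because
  \<open>\<omega> [W, J W]\<close> is positive.\<close>

lemma omega_orthogonal_projection:
  assumes "W \<noteq> 0"
  obtains a b where "\<omega> [X - (a *\<^sub>R W + b *\<^sub>R J W), W] = 0" "\<omega> [X - (a *\<^sub>R W + b *\<^sub>R J W), J W] = 0"
proof -
  define m where "m = Re (\<omega> [W, J W])"
  have m: "\<omega> [W, J W] = of_real m" "m \<noteq> 0"
    using omega_pos[OF assms] omega_real[of "[W, J W]"] by (simp_all add: m_def)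
  have "\<omega> [J W, W] = - of_real m" using omega_swap[of "J W" W] m by simp
  then show ?thesis
    using that[of "Re (\<omega> [X, J W]) / m" "- Re (\<omega> [X, W]) / m"] m
      omega_real[of "[X, W]"] omega_real[of "[X, J W]"]
    by (simp add: omega_simps)
qed

text \<open>The common kernel of \<open>\<zeta> 1\<close> and \<open>\<zeta> 2\<close> is a complex
  line with coordinate \<open>\<zeta> 3\<close>, so \<open>\<omega>\<close> restricts to a positive
  multiple of its area form.\<close>

lemma omega_center:
  obtains \<kappa> :: real where "\<kappa> > 0"
    "\<And>C C'. \<zeta> 1 [C] = 0 \<Longrightarrow> \<zeta> 2 [C] = 0 \<Longrightarrow> \<zeta> 1 [C'] = 0 \<Longrightarrow> \<zeta> 2 [C'] = 0 \<Longrightarrow>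
      \<omega> [C, C'] = \<i> * \<kappa> * (\<zeta> 3 [C] * cnj (\<zeta> 3 [C']) - \<zeta> 3 [C'] * cnj (\<zeta> 3 [C]))"
proof -
  obtain W where W: "\<zeta> 1 [W] = 0" "\<zeta> 2 [W] = 0" "\<zeta> 3 [W] = 1" by (rule zeta_surj)
  then have "W \<noteq> 0" by (auto simp: zeta_simps)
  define m where "m = Re (\<omega> [W, J W])"
  have m: "\<omega> [W, J W] = of_real m" "m > 0"
    using omega_pos[OF \<open>W \<noteq> 0\<close>] omega_real[of "[W, J W]"] by (simp_all add: m_def)
  have m': "\<omega> [J W, W] = - of_real m" using omega_swap[of "J W" W] m by simp
  have rep: "C = Re (\<zeta> 3 [C]) *\<^sub>R W + Im (\<zeta> 3 [C]) *\<^sub>R J W" if "\<zeta> 1 [C] = 0" "\<zeta> 2 [C] = 0" for C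
    by (rule zeta_eqI) (simp_all add: that zeta_simps W complex_eq_iff)
  show ?thesis
  \<comment> \<open>For \<open>C = W\<close> and \<open>C' = J W\<close> the right-hand side equals
    \<open>2 * \<kappa>\<close>.\<close>
  proof (rule that[of "m / 2"])
    fix C C'
    assume *: "\<zeta> 1 [C] = 0" "\<zeta> 2 [C] = 0" "\<zeta> 1 [C'] = 0" "\<zeta> 2 [C'] = 0"
    show "\<omega> [C, C'] = \<i> * of_real (m / 2) * (\<zeta> 3 [C] * cnj (\<zeta> 3 [C']) - \<zeta> 3 [C'] * cnj (\<zeta> 3 [C]))"
      apply (subst rep[OF *(1,2)], subst rep[OF *(3,4)])
      by (simp add: omega_simps m m' complex_eq_iff field_simps)
  qed (use m in simp)
qed

text \<open>Gram-Schmidt over the complex numbers, starting from \<open>W\<close>. Removing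
  multiples of \<open>W\<close> and \<open>J W\<close> leaves \<open>\<zeta> 1\<close> and
  \<open>\<zeta> 2\<close> unchanged; only the last step creates the entry \<open>t\<close>.\<close>

lemma orthogonal_frame:
  obtains W Y1 Y2 t where "\<zeta> 1 [W] = 0" "\<zeta> 2 [W] = 0" "\<zeta> 3 [W] = 1"
    "\<zeta> 1 [Y1] = 1" "\<zeta> 2 [Y1] = t" "\<zeta> 1 [Y2] = 0" "\<zeta> 2 [Y2] = 1"
    "\<omega> [Y1, W] = 0" "\<omega> [Y1, J W] = 0" "\<omega> [Y2, W] = 0" "\<omega> [Y2, J W] = 0"
    "\<omega> [Y1, Y2] = 0" "\<omega> [Y1, J Y2] = 0"
proof -
  obtain W where W: "\<zeta> 1 [W] = 0" "\<zeta> 2 [W] = 0" "\<zeta> 3 [W] = 1" by (rule zeta_surj)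
  obtain X1 where X1: "\<zeta> 1 [X1] = 1" "\<zeta> 2 [X1] = 0" "\<zeta> 3 [X1] = 0" by (rule zeta_surj)
  obtain X2 where X2: "\<zeta> 1 [X2] = 0" "\<zeta> 2 [X2] = 1" "\<zeta> 3 [X2] = 0" by (rule zeta_surj)
  have "W \<noteq> 0" using W by (auto simp: zeta_simps)
  from omega_orthogonal_projection[OF this, of X1] obtain a b where
    "\<omega> [X1 - (a *\<^sub>R W + b *\<^sub>R J W), W] = 0" "\<omega> [X1 - (a *\<^sub>R W + b *\<^sub>R J W), J W] = 0" by blast
  then obtain Z where Z: "\<omega> [Z, W] = 0" "\<omega> [Z, J W] = 0" "\<zeta> 1 [Z] = 1" "\<zeta> 2 [Z] = 0"
    using that[of "X1 - (a *\<^sub>R W + b *\<^sub>R J W)"] W X1 by (simp add: zeta_simps)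
  from omega_orthogonal_projection[OF \<open>W \<noteq> 0\<close>, of X2] obtain a b where
    "\<omega> [X2 - (a *\<^sub>R W + b *\<^sub>R J W), W] = 0" "\<omega> [X2 - (a *\<^sub>R W + b *\<^sub>R J W), J W] = 0" by blast
  then obtain Y2 where Y2: "\<omega> [Y2, W] = 0" "\<omega> [Y2, J W] = 0" "\<zeta> 1 [Y2] = 0" "\<zeta> 2 [Y2] = 1"
    using that[of "X2 - (a *\<^sub>R W + b *\<^sub>R J W)"] W X2 by (simp add: zeta_simps)
  then have "Y2 \<noteq> 0" by (auto simp: zeta_simps)
  from omega_orthogonal_projection[OF this, of Z] obtain a b where
    ab: "\<omega> [Z - (a *\<^sub>R Y2 + b *\<^sub>R J Y2), Y2] = 0" "\<omega> [Z - (a *\<^sub>R Y2 + b *\<^sub>R J Y2), J Y2] = 0" by blast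
  show ?thesis
    by (rule that[of W "Z - (a *\<^sub>R Y2 + b *\<^sub>R J Y2)" "- of_real a - \<i> * of_real b" Y2])
      (use ab in \<open>simp_all add: W Y2 Z\<close>, simp_all add: zeta_simps omega_simps omega_J_left W Y2 Z)
qed

text \<open>The derivative of \<open>\<omega> \<and>\<^sub>f \<omega>\<close> on the frame and a
  central vector yields one complex equation between \<open>l\<close>, \<open>x\<close>,
  \<open>y\<close> and \<open>t\<close>. Its real part forces \<open>2 * x < l\<^sup>2\<close>, and
  \<open>\<rho>\<close> is nonnegative.\<close>

lemma balanced_imp_pos:
  assumes "balanced br \<omega>"
  shows "\<rho> + l\<^sup>2 - 2 * x > 0"
proof -
  obtain W Y1 Y2 t where W: "\<zeta> 1 [W] = 0" "\<zeta> 2 [W] = 0" "\<zeta> 3 [W] = 1" and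
    Y: "\<zeta> 1 [Y1] = 1" "\<zeta> 2 [Y1] = t" "\<zeta> 1 [Y2] = 0" "\<zeta> 2 [Y2] = 1" and
    orth: "\<omega> [Y1, W] = 0" "\<omega> [Y1, J W] = 0" "\<omega> [Y2, W] = 0" "\<omega> [Y2, J W] = 0"
    "\<omega> [Y1, Y2] = 0" "\<omega> [Y1, J Y2] = 0" by (rule orthogonal_frame)
  have W': "\<zeta> 1 [J W] = 0" "\<zeta> 2 [J W] = 0" "\<zeta> 3 [J W] = \<i>" by (simp_all add: W)
  have "Y1 \<noteq> 0" "Y2 \<noteq> 0" using Y by (auto simp: zeta_simps)
  define m1 m2 where "m1 = Re (\<omega> [Y1, J Y1])" and "m2 = Re (\<omega> [Y2, J Y2])"
  have m: "\<omega> [Y1, J Y1] = of_real m1" "m1 > 0" "\<omega> [Y2, J Y2] = of_real m2" "m2 > 0"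
    using omega_pos[OF \<open>Y1 \<noteq> 0\<close>] omega_pos[OF \<open>Y2 \<noteq> 0\<close>] omega_real[of "[Y1, J Y1]"]
      omega_real[of "[Y2, J Y2]"] by (simp_all add: m1_def m2_def)
  define C where "C = m2 *\<^sub>R br Y1 (J Y1) + m1 *\<^sub>R br Y2 (J Y2)"
  have C: "\<zeta> 1 [C] = 0" "\<zeta> 2 [C] = 0" by (simp_all add: C_def zeta_simps)
  have zero: "\<omega> [C, U] = 0" if "\<zeta> 1 [U] = 0" "\<zeta> 2 [U] = 0" "\<omega> [Y1, U] = 0" "\<omega> [Y1, J U] = 0"
    "\<omega> [Y2, U] = 0" "\<omega> [Y2, J U] = 0" for U
  proof -
    have U: "\<omega> [J Y1, U] = 0" "\<omega> [J Y2, U] = 0" using that by (simp_all add: omega_J_left)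
    have JY: "\<omega> [J Y1, Y2] = 0" using orth by (simp add: omega_J_left)
    have wedge0: "(\<omega> \<and>\<^sub>f \<omega>) [0, P, Q, R] = 0" for P Q R
      by (simp add: omega_wedge_omega omega_simps)
    have wedge: "(\<omega> \<and>\<^sub>f \<omega>) [P, Q, R, U] = 2 * (\<omega> [P, U] * \<omega> [Q, R])"
      if "\<omega> [Q, U] = 0" "\<omega> [R, U] = 0" for P Q R
      by (simp add: omega_wedge_omega that)
    \<comment> \<open>Among the ten terms, brackets with \<open>U\<close> vanish by centrality and
      mixed brackets of the frame are multiplied by zero entries of \<open>\<omega>\<close>. Only
      \<open>br Y1 (J Y1)\<close> and \<open>br Y2 (J Y2)\<close> remain.\<close>
    have "ext_d br (\<omega> \<and>\<^sub>f \<omega>) [Y1, J Y1, Y2, J Y2, U] = 0"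
      using assms by (simp add: balanced_def)
    then have "- 2 * (of_real m2 * \<omega> [br Y1 (J Y1), U] + of_real m1 * \<omega> [br Y2 (J Y2), U]) = 0"
      by (simp only: ext_d_5 br_central(2)[OF that(1,2)] wedge0 wedge[OF that(3,5)] wedge[OF that(3) U(2)]
           wedge[OF U(1) that(5)] wedge[OF U] wedge[OF that(3) U(1)] wedge[OF that(5) U(2)] omega_J_J orth JY m)
         algebra
    then have "of_real m2 * \<omega> [br Y1 (J Y1), U] + of_real m1 * \<omega> [br Y2 (J Y2), U] = 0"
      unfolding mult_eq_0_iff by (elim disjE) (simp, assumption)
    then show ?thesis
      unfolding C_def omega_simps .
  qed
  obtain \<kappa> where \<kappa>: "\<kappa> > (0::real)"
    "\<And>C C'. \<zeta> 1 [C] = 0 \<Longrightarrow> \<zeta> 2 [C] = 0 \<Longrightarrow> \<zeta> 1 [C'] = 0 \<Longrightarrow> \<zeta> 2 [C'] = 0 \<Longrightarrow>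
      \<omega> [C, C'] = \<i> * \<kappa> * (\<zeta> 3 [C] * cnj (\<zeta> 3 [C']) - \<zeta> 3 [C'] * cnj (\<zeta> 3 [C]))"
    using omega_center by blast
  \<comment> \<open>Pairing \<open>C\<close> with \<open>W\<close> detects the imaginary part of
    \<open>\<zeta> 3 [C]\<close>, pairing with \<open>J W\<close> the real part.\<close>
  have "\<zeta> 3 [C] = 0"
    using zero[of W] zero[of "J W"] \<kappa>(1) W W' orth
    by (simp add: \<kappa>(2) C omega_simps complex_eq_iff)
  then have "2 * \<i> * (of_real m2 * (1 + l * cnj t + Complex x y * (t * cnj t)) + of_real m1 * Complex x y) = 0"
    by (simp add: C_def zeta_simps zeta_3_br Y algebra_simps)
  then have "of_real m2 * (1 + l * cnj t + Complex x y * (t * cnj t)) + of_real m1 * Complex x y = 0"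
    unfolding mult_eq_0_iff by simp
  then have "Re (of_real m2 * (1 + l * cnj t + Complex x y * (t * cnj t)) + of_real m1 * Complex x y) = 0"
    by simp
  then have eq: "m2 * (1 + l * Re t + x * ((Re t)\<^sup>2 + (Im t)\<^sup>2)) + m1 * x = 0"
    by (simp add: algebra_simps power2_eq_square)
  \<comment> \<open>By \<open>eq\<close>, the term \<open>- 2 * x * (m2 * ?q + m1)\<close> equals
    \<open>2 * m2 * (1 + l * Re t)\<close>; completing the square then exhibits a positive
    quantity.\<close>
  let ?q = "(Re t)\<^sup>2 + (Im t)\<^sup>2"
  have "l\<^sup>2 * (m2 * ?q + m1) - 2 * x * (m2 * ?q + m1) = m2 * ((1 + l * Re t)\<^sup>2 + 1 + (l * Im t)\<^sup>2) + l\<^sup>2 * m1"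
    using eq by (simp add: power2_eq_square algebra_simps)
  also have "\<dots> > 0" using m by (intro add_pos_nonneg mult_pos_pos add_nonneg_pos) auto
  finally have "(l\<^sup>2 - 2 * x) * (m2 * ?q + m1) > 0" by (simp add: algebra_simps)
  moreover have "m2 * ?q + m1 > 0" using m by (intro add_nonneg_pos) auto
  ultimately have "l\<^sup>2 - 2 * x > 0" by (simp add: zero_less_mult_iff)
  moreover have "\<rho> \<ge> 0" using coframe by (auto simp: adapted_coframe_def)
  ultimately show ?thesis by simp
qed

text \<open>With a central third argument, the Lee equation makes the bracket on the complement of
  the centre a fixed multiple of \<open>\<omega>\<close>. Orthogonal frame pairs then give
  \<open>\<rho> = l = 0\<close>, and the pairs \<open>Y1, J Y1\<close> and \<open>Y2, J Y2\<close>
  give \<open>x * m1 = m2\<close>.\<close>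

lemma lck_imp_neg:
  assumes "locally_conformally_kaehler br \<omega>"
  shows "\<rho> + l\<^sup>2 - 2 * x < 0"
proof -
  obtain W Y1 Y2 t where W: "\<zeta> 1 [W] = 0" "\<zeta> 2 [W] = 0" "\<zeta> 3 [W] = 1" and
    Y: "\<zeta> 1 [Y1] = 1" "\<zeta> 2 [Y1] = t" "\<zeta> 1 [Y2] = 0" "\<zeta> 2 [Y2] = 1" and
    orth: "\<omega> [Y1, W] = 0" "\<omega> [Y1, J W] = 0" "\<omega> [Y2, W] = 0" "\<omega> [Y2, J W] = 0"
    "\<omega> [Y1, Y2] = 0" "\<omega> [Y1, J Y2] = 0" by (rule orthogonal_frame)
  have W': "\<zeta> 1 [J W] = 0" "\<zeta> 2 [J W] = 0" "\<zeta> 3 [J W] = \<i>" by (simp_all add: W)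
  have "Y1 \<noteq> 0" "Y2 \<noteq> 0" using Y by (auto simp: zeta_simps)
  define m1 m2 where "m1 = Re (\<omega> [Y1, J Y1])" and "m2 = Re (\<omega> [Y2, J Y2])"
  have m: "\<omega> [Y1, J Y1] = of_real m1" "m1 > 0" "\<omega> [Y2, J Y2] = of_real m2" "m2 > 0"
    using omega_pos[OF \<open>Y1 \<noteq> 0\<close>] omega_pos[OF \<open>Y2 \<noteq> 0\<close>] omega_real[of "[Y1, J Y1]"]
      omega_real[of "[Y2, J Y2]"] by (simp_all add: m1_def m2_def)
  obtain \<theta> where \<theta>: "\<theta> \<in> forms 1" "ext_d br \<omega> = \<theta> \<and>\<^sub>f \<omega>"
    using assms by (auto simp: locally_conformally_kaehler_def)
  have \<theta>_length: "length v \<noteq> 1 \<Longrightarrow> \<theta> v = 0" for v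
    using \<theta>(1) by (simp add: forms_def)
  have d: "- \<omega> [br X Y, U] = \<theta> [U] * \<omega> [X, Y]"
    if "\<zeta> 1 [U] = 0" "\<zeta> 2 [U] = 0" "\<omega> [X, U] = 0" "\<omega> [Y, U] = 0" for X Y U
  proof -
    have "ext_d br \<omega> [X, Y, U] = (\<theta> \<and>\<^sub>f \<omega>) [X, Y, U]" by (simp add: \<theta>(2))
    then show ?thesis
      by (simp add: ext_d_3 wedge_1_2 \<theta>_length omega_length br_central that omega_simps)
  qed
  obtain \<kappa> where \<kappa>: "\<kappa> > (0::real)"
    "\<And>C C'. \<zeta> 1 [C] = 0 \<Longrightarrow> \<zeta> 2 [C] = 0 \<Longrightarrow> \<zeta> 1 [C'] = 0 \<Longrightarrow> \<zeta> 2 [C'] = 0 \<Longrightarrow>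
      \<omega> [C, C'] = \<i> * \<kappa> * (\<zeta> 3 [C] * cnj (\<zeta> 3 [C']) - \<zeta> 3 [C'] * cnj (\<zeta> 3 [C]))"
    using omega_center by blast
  \<comment> \<open>This combination of the pairings with \<open>W\<close> and \<open>J W\<close>
    isolates \<open>\<zeta> 3\<close> of a bracket from its conjugate.\<close>
  define q where "q = (\<i> * \<theta> [W] - \<theta> [J W]) / (2 * \<kappa>)"
  have br: "\<zeta> 3 [br X Y] = q * \<omega> [X, Y]"
    if "\<omega> [X, W] = 0" "\<omega> [X, J W] = 0" "\<omega> [Y, W] = 0" "\<omega> [Y, J W] = 0" for X Y
  proof -
    have "- \<omega> [br X Y, W] = \<theta> [W] * \<omega> [X, Y]" "- \<omega> [br X Y, J W] = \<theta> [J W] * \<omega> [X, Y]"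
      using that W W' by (simp_all add: d)
    moreover have "\<omega> [br X Y, W] = \<i> * \<kappa> * (\<zeta> 3 [br X Y] - cnj (\<zeta> 3 [br X Y]))"
      "\<omega> [br X Y, J W] = \<kappa> * (\<zeta> 3 [br X Y] + cnj (\<zeta> 3 [br X Y]))"
      by (simp_all add: \<kappa>(2) W W' algebra_simps)
    ultimately have 1: "\<theta> [W] * \<omega> [X, Y] = - (\<i> * \<kappa> * (\<zeta> 3 [br X Y] - cnj (\<zeta> 3 [br X Y])))"
      and 2: "\<theta> [J W] * \<omega> [X, Y] = - \<kappa> * (\<zeta> 3 [br X Y] + cnj (\<zeta> 3 [br X Y]))"
      by simp_all
    have "(\<i> * \<theta> [W] - \<theta> [J W]) * \<omega> [X, Y] = \<i> * (\<theta> [W] * \<omega> [X, Y]) - \<theta> [J W] * \<omega> [X, Y]"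
      by (simp add: algebra_simps)
    also have "\<dots> = 2 * \<kappa> * \<zeta> 3 [br X Y]"
      unfolding 1 2 by (simp add: algebra_simps)
    finally show ?thesis using \<kappa>(1) by (simp add: q_def field_simps)
  qed
  define D where "D = Complex x y"
  note b = zeta_3_br[folded D_def] Y
  \<comment> \<open>The next three equations come from pairs on which \<open>\<omega>\<close>
    vanishes.\<close>
  have e1: "of_real \<rho> + of_real l + D * (t - cnj t) = 0"
    using br[of Y1 Y2] by (simp add: orth b minus_equation_iff[of _ 0] add_eq_0_iff)
  have "\<i> * (of_real \<rho> + of_real l + D * (t + cnj t)) = 0"
    using br[of "J Y1" Y2] by (simp add: orth b omega_simps omega_J_left algebra_simps) (metis add.right_inverse)
  then have e2: "of_real \<rho> + of_real l + D * (t + cnj t) = 0" by simp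
  have e3: "- of_real \<rho> + of_real l + D * (t - cnj t) = 0"
    using br[of "J Y1" "J Y2"] by (simp add: orth b omega_simps omega_J_left algebra_simps)
  have "of_real \<rho> = (0 :: complex)" using e1 e3 by algebra
  then have "\<rho> = 0" by simp
  have "D * cnj t = 0" using e1 e2 by algebra
  then have "D = 0 \<or> t = 0" by auto
  then have "l = 0" "D * t = 0" using e1 \<open>\<rho> = 0\<close> by auto
  have "2 * \<i> = q * m1" "2 * \<i> * D = q * m2"
    using br[of Y1 "J Y1"] br[of Y2 "J Y2"] \<open>l = 0\<close> \<open>\<rho> = 0\<close> \<open>D = 0 \<or> t = 0\<close>
    by (auto simp: orth b omega_simps omega_J_left m mult_ac)
  \<comment> \<open>Multiply the first equation by \<open>D\<close> and subtract the second.\<close>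
  then have "q * (D * m1 - m2) = 0" by algebra
  moreover have "q \<noteq> 0" using \<open>2 * \<i> = q * m1\<close> by auto
  ultimately have "D * m1 = of_real m2" by simp
  then have "Re (D * m1) = m2" by simp
  then have "x * m1 = m2" by (simp add: D_def)
  then have "x > 0" using m zero_less_mult_pos2[of x m1] by simp
  then show ?thesis using \<open>l = 0\<close> \<open>\<rho> = 0\<close> by simp
qed

end

section \<open>The form del delbar omega\<close>

lemma pq_part_zero: "pq_part J p q (\<lambda>_. 0) = (\<lambda>_. 0)"
  by (simp add: pq_part_def fun_eq_iff)

lemma ext_d_zero: "ext_d br (\<lambda>_. 0) = (\<lambda>_. 0)"
  by (simp add: ext_d_def fun_eq_iff)

text \<open>The projection reads only lists of length \<open>p + q\<close>; this disposes of the
  degrees in which \<open>del\<close> and \<open>delbar\<close> must give zero.\<close>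

lemma pq_part_degree:
  assumes "\<And>v. length v = p + q \<Longrightarrow> \<alpha> v = 0"
  shows "pq_part J p q \<alpha> = (\<lambda>_. 0)"
  by (simp add: pq_part_def fun_eq_iff assms)

text \<open>Type projections are idempotent and annihilate each other. Compatibility with signs lets
  \<open>J (J X)\<close> be replaced and the minus sign pulled out.\<close>

lemma pq_part_pq_part_3:
  assumes "\<And>X. J (J X) = - X"
    and "\<And>X Y Z. \<gamma> [- X, Y, Z] = - \<gamma> [X, Y, Z]" "\<And>X Y Z. \<gamma> [X, - Y, Z] = - \<gamma> [X, Y, Z]"
      "\<And>X Y Z. \<gamma> [X, Y, - Z] = - \<gamma> [X, Y, Z]"
  shows "pq_part J 3 0 (pq_part J 1 2 \<gamma>) [X, Y, Z] = 0"
    "pq_part J 2 1 (pq_part J 1 2 \<gamma>) [X, Y, Z] = 0"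
    "pq_part J 1 2 (pq_part J 1 2 \<gamma>) [X, Y, Z] = pq_part J 1 2 \<gamma> [X, Y, Z]"
    "pq_part J 0 3 (pq_part J 1 2 \<gamma>) [X, Y, Z] = 0"
  unfolding pq_part_3 assms by (simp_all add: field_simps)

lemma length_3_cases:
  assumes "length v = 3"
  obtains X Y Z where "v = [X, Y, Z]"
  using assms by (auto simp: eval_nat_numeral length_Suc_conv)

text \<open>Here \<open>r d\<close> and \<open>p\<close> stand for the (2,0) and (1,1) parts of \<open>d \<zeta>\<^sup>3\<close>, and the complex conjugates
  \<open>A, B, dc, pc, Dc\<close> are independent variables, so that the identity is polynomial.\<close>

lemma alternating_sum_identity:
  fixes a b A B :: "'i \<Rightarrow> 'b::comm_ring_1"
  assumes "\<And>i j. d i j = a i * b j - a j * b i" "\<And>i j. dc i j = A i * B j - A j * B i"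
    and "\<And>i j. p i j = a i * A j - a j * A i + l * (a i * B j - a j * B i) + D * (b i * B j - b j * B i)"
    and "\<And>i j. pc i j = A i * a j - A j * a i + l * (A i * b j - A j * b i) + Dc * (B i * b j - B j * b i)"
    and "\<And>i j m n. f i j m n = (r * d i j + p i j) * (r * dc m n) - (r * dc i j + pc i j) * p m n"
  shows "- f i j m n + f i m j n - f i n j m - f j m i n + f j n i m - f m n i j =
    (r\<^sup>2 + l\<^sup>2 - D - Dc) * (- d i j * dc m n + d i m * dc j n - d i n * dc j m
       - d j m * dc i n + d j n * dc i m - d m n * dc i j)"
proof -
  \<comment> \<open>The terms linear in \<open>r\<close> cancel between \<open>f i j m n\<close> and
    \<open>f m n i j\<close>, which carry the same sign, and likewise in the other two
    pairs.\<close>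
  have "- f i j m n + f i m j n - f i n j m - f j m i n + f j n i m - f m n i j =
    r\<^sup>2 * (- d i j * dc m n + d i m * dc j n - d i n * dc j m
       - d j m * dc i n + d j n * dc i m - d m n * dc i j)
    - (- pc i j * p m n + pc i m * p j n - pc i n * p j m
       - pc j m * p i n + pc j n * p i m - pc m n * p i j)"
    unfolding assms(5) by (simp add: algebra_simps power2_eq_square)
  \<comment> \<open>Both sides are multiples of the full wedge of \<open>a\<close>,
    \<open>b\<close>, \<open>A\<close>, \<open>B\<close>; the factor comes from comparing
    coefficients.\<close>
  also have "- pc i j * p m n + pc i m * p j n - pc i n * p j m
       - pc j m * p i n + pc j n * p i m - pc m n * p i j =
    (D + Dc - l\<^sup>2) * (- d i j * dc m n + d i m * dc j n - d i n * dc j m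
       - d j m * dc i n + d j n * dc i m - d m n * dc i j)"
    unfolding assms(1-4) by (simp add: algebra_simps power2_eq_square)
  finally show ?thesis by (simp add: algebra_simps)
qed

context adapted_coframe_metric
begin

section \<open>Reduction of \<open>del\<close> and \<open>delbar\<close> to single type
  components\<close>

abbreviation (input) delbar_form :: "'g form" where
  "delbar_form \<equiv> pq_part J 1 2 (ext_d br \<omega>)"

text \<open>Invariance under \<open>J\<close> makes \<open>\<omega>\<close> of type (1,1), so one
  summand survives.\<close>

lemma delbar_omega: "delbar br J \<omega> = pq_part J 1 2 (ext_d br \<omega>)"
proof
  fix v :: "'g list"
  have parts: "pq_part J 2 0 \<omega> = (\<lambda>_. 0)" "pq_part J 0 2 \<omega> = (\<lambda>_. 0)" "pq_part J 1 1 \<omega> = \<omega>"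
  proof -
    have "pq_part J 2 0 \<omega> w = 0 \<and> pq_part J 0 2 \<omega> w = 0 \<and> pq_part J 1 1 \<omega> w = \<omega> w" for w
    proof (cases "length w = 2")
      case True
      then obtain X Y where "w = [X, Y]" by (auto simp: eval_nat_numeral length_Suc_conv)
      then show ?thesis by (simp only: pq_part_2 omega_J_J omega_J_left) (simp add: omega_simps)
    next
      case False
      then show ?thesis by (simp add: pq_part_def omega_length)
    qed
    then show "pq_part J 2 0 \<omega> = (\<lambda>_. 0)" "pq_part J 0 2 \<omega> = (\<lambda>_. 0)" "pq_part J 1 1 \<omega> = \<omega>"
      by auto
  qed
  show "delbar br J \<omega> v = pq_part J 1 2 (ext_d br \<omega>) v"
  proof (cases "length v = 3")
    case True
    have "{(p, q). p + q + 1 = (3::nat)} = {(2, 0), (1, 1), (0, 2)}" by auto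
    then show ?thesis
      unfolding delbar_def True
      by (simp add: parts[unfolded One_nat_def numeral_2_eq_2] pq_part_zero ext_d_zero eval_nat_numeral)
  next
    case False
    have "pq_part J p (q + 1) (ext_d br (pq_part J p q \<omega>)) v = 0" if "p + q + 1 = length v" for p q
      using that False by (subst (2) pq_part_degree) (auto simp: omega_length ext_d_zero pq_part_zero)
    then show ?thesis
      using False by (auto simp: delbar_def pq_part_def intro!: sum.neutral)
  qed
qed

lemma br_minus: "br (- X) Y = - br X Y" "br X (- Y) = - br X Y"
  using lie by (simp_all add: lie_bracket_def bilinear_lneg bilinear_rneg)

lemma ext_d_omega_minus:
  "ext_d br \<omega> [- X, Y, Z] = - ext_d br \<omega> [X, Y, Z]"
  "ext_d br \<omega> [X, - Y, Z] = - ext_d br \<omega> [X, Y, Z]"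
  "ext_d br \<omega> [X, Y, - Z] = - ext_d br \<omega> [X, Y, Z]"
  by (simp_all add: ext_d_3 br_minus omega_simps)

lemma del_delbar_omega: "del br J (delbar br J \<omega>) = pq_part J 2 2 (ext_d br (pq_part J 1 2 (ext_d br \<omega>)))"
proof
  fix v :: "'g list"
  have parts: "pq_part J 3 0 delbar_form = (\<lambda>_. 0)" "pq_part J 2 1 delbar_form = (\<lambda>_. 0)"
    "pq_part J 1 2 delbar_form = delbar_form" "pq_part J 0 3 delbar_form = (\<lambda>_. 0)"
  proof -
    have "pq_part J 3 0 delbar_form w = 0 \<and> pq_part J 2 1 delbar_form w = 0 \<and> pq_part J 1 2 delbar_form w = delbar_form w
      \<and> pq_part J 0 3 delbar_form w = 0" for w
    proof (cases "length w = 3")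
      case True
      then obtain X Y Z where "w = [X, Y, Z]" by (rule length_3_cases)
      then show ?thesis using pq_part_pq_part_3[OF J_J ext_d_omega_minus] by blast
    next
      case False
      then show ?thesis by (simp add: pq_part_def)
    qed
    then show "pq_part J 3 0 delbar_form = (\<lambda>_. 0)" "pq_part J 2 1 delbar_form = (\<lambda>_. 0)"
    "pq_part J 1 2 delbar_form = delbar_form" "pq_part J 0 3 delbar_form = (\<lambda>_. 0)"
      by blast+
  qed
  show "del br J (delbar br J \<omega>) v = pq_part J 2 2 (ext_d br delbar_form) v"
  proof (cases "length v = 4")
    case True
    have "{(p, q). p + q + 1 = (4::nat)} = {(3, 0), (2, 1), (1, 2), (0, 3)}" by auto
    then show ?thesis
      unfolding del_def True delbar_omega
      by (simp add: parts[unfolded One_nat_def numeral_2_eq_2 numeral_3_eq_3] pq_part_zero ext_d_zero eval_nat_numeral)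
  next
    case False
    have "pq_part J (p + 1) q (ext_d br (pq_part J p q delbar_form)) v = 0" if "p + q + 1 = length v" for p q
    proof -
      have "pq_part J p q delbar_form = (\<lambda>_. 0)"
        using that False by (intro pq_part_degree) (simp add: pq_part_def)
      then show ?thesis by (simp add: ext_d_zero pq_part_zero)
    qed
    then show ?thesis
      using False by (auto simp: del_def delbar_omega pq_part_def[of J 2 2] intro!: sum.neutral)
  qed
qed

text \<open>Every term of the differential contains a bracket, which is central, and there
  \<open>omega_center\<close> determines the form. The alternating sum in the conclusion is minus
  the wedge of \<open>d\<close> with its conjugate.\<close>

lemma ext_d_delbar_omega:
  obtains \<kappa> :: real where "\<kappa> > 0"
    "\<And>X Y Z W. ext_d br delbar_form [X, Y, Z, W] = \<i> * \<kappa> * of_real (\<rho> + l\<^sup>2 - 2 * x) *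
      (let d = (\<lambda>X Y. \<zeta> 1 [X] * \<zeta> 2 [Y] - \<zeta> 1 [Y] * \<zeta> 2 [X]) in
       - d X Y * cnj (d Z W) + d X Z * cnj (d Y W) - d X W * cnj (d Y Z)
       - d Y Z * cnj (d X W) + d Y W * cnj (d X Z) - d Z W * cnj (d X Y))"
proof -
  obtain \<kappa> where \<kappa>: "\<kappa> > (0::real)"
    "\<And>C C'. \<zeta> 1 [C] = 0 \<Longrightarrow> \<zeta> 2 [C] = 0 \<Longrightarrow> \<zeta> 1 [C'] = 0 \<Longrightarrow> \<zeta> 2 [C'] = 0 \<Longrightarrow>
      \<omega> [C, C'] = \<i> * \<kappa> * (\<zeta> 3 [C] * cnj (\<zeta> 3 [C']) - \<zeta> 3 [C'] * cnj (\<zeta> 3 [C]))"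
    using omega_center by blast
  \<comment> \<open>The differential of \<open>\<zeta> 3\<close> is \<open>\<rho>\<close> times
    \<open>d\<close>, of type (2,0), plus \<open>p\<close>, of type (1,1).\<close>
  define d where "d X Y = \<zeta> 1 [X] * \<zeta> 2 [Y] - \<zeta> 1 [Y] * \<zeta> 2 [X]" for X Y
  define p where "p X Y = \<zeta> 1 [X] * cnj (\<zeta> 1 [Y]) - \<zeta> 1 [Y] * cnj (\<zeta> 1 [X])
   + of_real l * (\<zeta> 1 [X] * cnj (\<zeta> 2 [Y]) - \<zeta> 1 [Y] * cnj (\<zeta> 2 [X]))
   + Complex x y * (\<zeta> 2 [X] * cnj (\<zeta> 2 [Y]) - \<zeta> 2 [Y] * cnj (\<zeta> 2 [X]))" for X Y
  have z3: "\<zeta> 3 [br X Y] = - (of_real \<rho> * d X Y + p X Y)" for X Y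
    by (simp only: zeta_3_br d_def p_def add.assoc)
  have dJ: "d (J X) Y = \<i> * d X Y" "d X (J Y) = \<i> * d X Y" for X Y
    by (simp_all add: d_def algebra_simps)
  have pJ: "p (J X) (J Y) = p X Y" "p (J X) Y = - p X (J Y)" "p X (- Y) = - p X Y" for X Y
    by (simp_all add: p_def zeta_simps algebra_simps)
  have \<gamma>: "ext_d br \<omega> [C, X, Y] = \<i> * \<kappa> * (\<zeta> 3 [br X Y] * cnj (\<zeta> 3 [C]) - \<zeta> 3 [C] * cnj (\<zeta> 3 [br X Y])) * (-1)"
    if "\<zeta> 1 [C] = 0" "\<zeta> 2 [C] = 0" for C X Y
    by (simp add: ext_d_3 br_central that omega_simps \<kappa>(2))
  \<comment> \<open>Of the four products in \<open>\<gamma>\<close>, these two have type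
    (1,2).\<close>
  have \<beta>: "delbar_form [C, X, Y] = \<i> * \<kappa> * (cnj (\<zeta> 3 [C]) * p X Y - \<zeta> 3 [C] * (of_real \<rho> * cnj (d X Y)))"
    if C: "\<zeta> 1 [C] = 0" "\<zeta> 2 [C] = 0" for C X Y
  proof -
    have "\<zeta> 1 [J C] = 0" "\<zeta> 2 [J C] = 0" using C by simp_all
    then show ?thesis
      unfolding pq_part_3 by (simp add: C \<gamma> z3 dJ pJ field_simps)
  qed
  show ?thesis
  proof (rule that[OF \<kappa>(1)])
    fix X Y Z W
    have "\<rho>\<^sup>2 = \<rho>" using coframe by (auto simp: adapted_coframe_def)
    \<comment> \<open>Since \<open>\<rho>\<close> is 0 or 1, its square in the polynomial identity
      may be replaced by \<open>\<rho>\<close>; the two complex numbers add up to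
      \<open>2 * x\<close>.\<close>
    then have E: "of_real (\<rho> + l\<^sup>2 - 2 * x) = (of_real \<rho>)\<^sup>2 + (of_real l)\<^sup>2 - Complex x y - Complex x (- y)"
      by (simp add: complex_eq_iff flip: of_real_power)
    define f where "f X Y Z W = (of_real \<rho> * d X Y + p X Y) * (of_real \<rho> * cnj (d Z W))
      - (of_real \<rho> * cnj (d X Y) + cnj (p X Y)) * p Z W" for X Y Z W
    have central: "delbar_form [br X Y, Z, W] = \<i> * \<kappa> * f X Y Z W" for X Y Z W
      by (simp only: \<beta> zeta_br z3 f_def) (simp add: algebra_simps)
    have "ext_d br delbar_form [X, Y, Z, W] = \<i> * \<kappa> *
      (- f X Y Z W + f X Z Y W - f X W Y Z - f Y Z X W + f Y W X Z - f Z W X Y)"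
      unfolding ext_d_4 central by (simp add: algebra_simps)
    also have "- f X Y Z W + f X Z Y W - f X W Y Z - f Y Z X W + f Y W X Z - f Z W X Y =
      of_real (\<rho> + l\<^sup>2 - 2 * x) * (- d X Y * cnj (d Z W) + d X Z * cnj (d Y W) - d X W * cnj (d Y Z)
       - d Y Z * cnj (d X W) + d Y W * cnj (d X Z) - d Z W * cnj (d X Y))"
      unfolding E by (rule alternating_sum_identity[where a = "\<lambda>X. \<zeta> 1 [X]" and b = "\<lambda>X. \<zeta> 2 [X]" and
         A = "\<lambda>X. cnj (\<zeta> 1 [X])" and B = "\<lambda>X. cnj (\<zeta> 2 [X])" and p = p and pc = "\<lambda>X Y. cnj (p X Y)"])
        (simp_all add: d_def p_def f_def complex_cnj)
    finally show "ext_d br delbar_form [X, Y, Z, W] = \<i> * \<kappa> * of_real (\<rho> + l\<^sup>2 - 2 * x) *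
      (let d = (\<lambda>X Y. \<zeta> 1 [X] * \<zeta> 2 [Y] - \<zeta> 1 [Y] * \<zeta> 2 [X]) in
       - d X Y * cnj (d Z W) + d X Z * cnj (d Y W) - d X W * cnj (d Y Z)
       - d Y Z * cnj (d X W) + d Y W * cnj (d X Z) - d Z W * cnj (d X Y))"
      unfolding Let_def d_def by (simp only: mult.assoc)
  qed
qed

lemma ddbar_omega:
  obtains \<kappa> :: real where "\<kappa> > 0"
    "\<And>X Y. del br J (delbar br J \<omega>) [X, J X, Y, J Y] =
      - \<i> * of_real (\<kappa> * (cmod (\<zeta> 1 [X] * \<zeta> 2 [Y] - \<zeta> 1 [Y] * \<zeta> 2 [X]))\<^sup>2 * (\<rho> + l\<^sup>2 - 2 * x))"
proof -
  define d where "d X Y = \<zeta> 1 [X] * \<zeta> 2 [Y] - \<zeta> 1 [Y] * \<zeta> 2 [X]" for X Y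
  define \<Delta> where "\<Delta> X Y Z W = - d X Y * cnj (d Z W) + d X Z * cnj (d Y W) - d X W * cnj (d Y Z)
       - d Y Z * cnj (d X W) + d Y W * cnj (d X Z) - d Z W * cnj (d X Y)" for X Y Z W
  obtain \<kappa> :: real where \<kappa>: "\<kappa> > 0"
    "\<And>X Y Z W. ext_d br delbar_form [X, Y, Z, W] = \<i> * \<kappa> * of_real (\<rho> + l\<^sup>2 - 2 * x) * \<Delta> X Y Z W"
    using ext_d_delbar_omega unfolding Let_def d_def[symmetric] \<Delta>_def[symmetric] by blast
  show ?thesis
  proof (rule that[of "4 * \<kappa>"])
    fix X Y
    have dJ: "d (J X) Y = \<i> * d X Y" "d X (J Y) = \<i> * d X Y" "d X X = 0" "d (- X) Y = - d X Y"
      "d X (- Y) = - d X Y" for X Y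
      by (simp_all add: d_def zeta_simps algebra_simps)
    \<comment> \<open>Four of the six mixed terms have proportional arguments and vanish. The rest
      agree with the original value, so the weights 3 + 2 + 3 over 8 return it unchanged.\<close>
    have \<Delta>: "\<Delta> X (J X) Y (J Y) = - 4 * (d X Y * cnj (d X Y))"
      "\<Delta> (J X) (J (J X)) Y (J Y) = - 4 * (d X Y * cnj (d X Y))"
      "\<Delta> X (J X) (J Y) (J (J Y)) = - 4 * (d X Y * cnj (d X Y))"
      "\<Delta> (J X) (J (J X)) (J Y) (J (J Y)) = - 4 * (d X Y * cnj (d X Y))"
      "\<Delta> (J X) (J X) (J Y) (J Y) = 0" "\<Delta> (J X) (J X) Y (J (J Y)) = 0"
      "\<Delta> X (J (J X)) (J Y) (J Y) = 0" "\<Delta> X (J (J X)) Y (J (J Y)) = 0"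
      unfolding \<Delta>_def by (simp_all add: dJ algebra_simps)
    have "del br J (delbar br J \<omega>) [X, J X, Y, J Y] =
      - \<i> * of_real (4 * \<kappa>) * (d X Y * cnj (d X Y)) * of_real (\<rho> + l\<^sup>2 - 2 * x)"
      unfolding del_delbar_omega pq_part_2_2 \<kappa>(2) \<Delta> by (simp add: field_simps)
    then show "del br J (delbar br J \<omega>) [X, J X, Y, J Y] = - \<i> * of_real (4 * \<kappa> *
        (cmod (\<zeta> 1 [X] * \<zeta> 2 [Y] - \<zeta> 1 [Y] * \<zeta> 2 [X]))\<^sup>2 * (\<rho> + l\<^sup>2 - 2 * x))"
      unfolding d_def[symmetric] of_real_mult complex_norm_square by (simp only: mult.assoc)
  qed (use \<kappa> in simp)
qed

text \<open>One direction tests the form on vectors dual to \<open>\<zeta> 1\<close> and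
  \<open>\<zeta> 2\<close>; conversely, a zero factor kills the whole differential of
  \<open>delbar_form\<close>.\<close>

lemma pluriclosed_iff: "pluriclosed br J \<omega> \<longleftrightarrow> \<rho> + l\<^sup>2 - 2 * x = 0"
proof
  obtain X where X: "\<zeta> 1 [X] = 1" "\<zeta> 2 [X] = 0" "\<zeta> 3 [X] = 0" by (rule zeta_surj)
  obtain Y where Y: "\<zeta> 1 [Y] = 0" "\<zeta> 2 [Y] = 1" "\<zeta> 3 [Y] = 0" by (rule zeta_surj)
  obtain \<kappa> :: real where \<kappa>: "\<kappa> > 0" "\<And>X Y. del br J (delbar br J \<omega>) [X, J X, Y, J Y] =
      - \<i> * of_real (\<kappa> * (cmod (\<zeta> 1 [X] * \<zeta> 2 [Y] - \<zeta> 1 [Y] * \<zeta> 2 [X]))\<^sup>2 * (\<rho> + l\<^sup>2 - 2 * x))"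
    by (rule ddbar_omega) (rule that)
  assume "pluriclosed br J \<omega>"
  then have "del br J (delbar br J \<omega>) [X, J X, Y, J Y] = 0" by (simp add: pluriclosed_def)
  then have "complex_of_real (\<kappa> * (\<rho> + l\<^sup>2 - 2 * x)) = 0" unfolding \<kappa>(2) by (simp add: X Y)
  then show "\<rho> + l\<^sup>2 - 2 * x = 0" using \<kappa>(1) unfolding of_real_eq_0_iff by simp
next
  assume E: "\<rho> + l\<^sup>2 - 2 * x = 0"
  have "ext_d br delbar_form v = 0" if "length v = 2 + 2" for v
  proof -
    have "length v = Suc (Suc (Suc (Suc 0)))" using that by simp
    then obtain X Y Z W where "v = [X, Y, Z, W]" by (auto simp: length_Suc_conv)
    show ?thesis
      unfolding \<open>v = [X, Y, Z, W]\<close> by (rule ext_d_delbar_omega) (simp only: E, simp)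
  qed
  then show "pluriclosed br J \<omega>"
    unfolding pluriclosed_def del_delbar_omega by (rule pq_part_degree)
qed

end

text \<open>Both coframes compute the same number from \<open>\<omega>\<close>. On vectors dual to
  \<open>\<zeta>'\<close> its factor is positive and the other is nonnegative, so strict signs
  transfer; exchanging the coframes gives the converse.\<close>

lemma adapted_coframe_sgn:
  fixes \<omega> :: "'g::euclidean_space form"
  assumes "adapted_coframe_metric br J \<zeta> \<rho> l x y \<omega>" "adapted_coframe_metric br J \<zeta>' \<rho>' l' x' y' \<omega>"
  shows "sgn (\<rho>' + l'\<^sup>2 - 2 * x') = sgn (\<rho> + l\<^sup>2 - 2 * x)"
proof -
  have *: "E' > 0 \<longrightarrow> E > 0" "E' < 0 \<longrightarrow> E < 0"
    if asm: "adapted_coframe_metric br J \<zeta> \<rho> l x y \<omega>" "adapted_coframe_metric br J \<zeta>' \<rho>' l' x' y' \<omega>"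
       "E = \<rho> + l\<^sup>2 - 2 * x" "E' = \<rho>' + l'\<^sup>2 - 2 * x'"
    for \<zeta> \<zeta>' \<rho> l x y \<rho>' l' x' y' E E'
  proof -
    interpret a: adapted_coframe_metric br J \<zeta> \<rho> l x y \<omega> by fact
    interpret b: adapted_coframe_metric br J \<zeta>' \<rho>' l' x' y' \<omega> by fact
    obtain X where X: "\<zeta>' 1 [X] = 1" "\<zeta>' 2 [X] = 0" "\<zeta>' 3 [X] = 0" by (rule b.zeta_surj)
    obtain Y where Y: "\<zeta>' 1 [Y] = 0" "\<zeta>' 2 [Y] = 1" "\<zeta>' 3 [Y] = 0" by (rule b.zeta_surj)
    obtain \<kappa> :: real where \<kappa>: "\<kappa> > 0" "\<And>X Y. del br J (delbar br J \<omega>) [X, J X, Y, J Y] =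
      - \<i> * of_real (\<kappa> * (cmod (\<zeta> 1 [X] * \<zeta> 2 [Y] - \<zeta> 1 [Y] * \<zeta> 2 [X]))\<^sup>2 * E)"
      by (rule a.ddbar_omega[folded asm(3)]) (rule that)
    obtain \<kappa>' :: real where \<kappa>': "\<kappa>' > 0" "\<And>X Y. del br J (delbar br J \<omega>) [X, J X, Y, J Y] =
      - \<i> * of_real (\<kappa>' * (cmod (\<zeta>' 1 [X] * \<zeta>' 2 [Y] - \<zeta>' 1 [Y] * \<zeta>' 2 [X]))\<^sup>2 * E')"
      by (rule b.ddbar_omega[folded asm(4)]) (rule that)
    define c where "c = \<kappa> * (cmod (\<zeta> 1 [X] * \<zeta> 2 [Y] - \<zeta> 1 [Y] * \<zeta> 2 [X]))\<^sup>2"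
    have "c \<ge> 0" using \<kappa>(1) by (simp add: c_def)
    have "- \<i> * of_real (c * E) = - \<i> * of_real (\<kappa>' * E')"
      using \<kappa>(2)[of X Y, folded c_def] \<kappa>'(2)[of X Y] by (simp add: X Y)
    then have "complex_of_real (c * E) = of_real (\<kappa>' * E')" by simp
    then have "c * E = \<kappa>' * E'" unfolding of_real_eq_iff .
    moreover have "0 < \<kappa>' * E' \<longleftrightarrow> 0 < E'" "\<kappa>' * E' < 0 \<longleftrightarrow> E' < 0"
      using \<kappa>'(1) by (auto simp: zero_less_mult_iff mult_less_0_iff)
    moreover have "0 < c * E \<longrightarrow> 0 < E" "c * E < 0 \<longrightarrow> E < 0"
      using \<open>c \<ge> 0\<close> by (auto simp: zero_less_mult_iff mult_less_0_iff)
    ultimately show "E' > 0 \<longrightarrow> E > 0" "E' < 0 \<longrightarrow> E < 0" by auto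
  qed
  show ?thesis
    using *[OF assms refl refl] *[OF assms(2,1) refl refl] by (auto simp: sgn_if)
qed

section \<open>Positivity of the metric matrix\<close>

text \<open>The Hermitian form of \<open>metric_matrix\<close> at \<open>(a, b, c)\<close>, equal to
  \<open>\<omega> [X, J X]\<close> for a vector with these coframe values.\<close>

definition hermitian_square ::
    "real \<Rightarrow> real \<Rightarrow> real \<Rightarrow> complex \<Rightarrow> complex \<Rightarrow> complex \<Rightarrow> complex \<Rightarrow> complex \<Rightarrow> complex \<Rightarrow> complex" where
  "hermitian_square r s k u v z a b c =
    (of_real r)\<^sup>2 * (a * cnj a) + (of_real s)\<^sup>2 * (b * cnj b) + (of_real k)\<^sup>2 * (c * cnj c)
    - \<i> * u * a * cnj b + \<i> * cnj u * b * cnj a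
    - \<i> * v * b * cnj c + \<i> * cnj v * c * cnj b
    - \<i> * z * a * cnj c + \<i> * cnj z * c * cnj a"

lemma complex_minor:
  "complex_of_real (r\<^sup>2 * k\<^sup>2 - (cmod z)\<^sup>2) = (of_real r)\<^sup>2 * (of_real k)\<^sup>2 - z * cnj z"
  unfolding of_real_diff complex_norm_square by simp

text \<open>The argument comes from the adjugate of the block with indices 1 and 3.\<close>

lemma hermitian_square_minor:
  "hermitian_square r s k u v z (of_real (k\<^sup>2)) 0 (\<i> * z) = of_real (k\<^sup>2 * (r\<^sup>2 * k\<^sup>2 - (cmod z)\<^sup>2))"
  unfolding of_real_mult[of "k\<^sup>2"] complex_minor hermitian_square_def
  by (simp add: algebra_simps power2_eq_square)

text \<open>The second column of the adjugate matrix is an argument at which the Hermitian form takes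
  the value determinant times minor.\<close>

lemma hermitian_square_det:
  "hermitian_square r s k u v z (v * cnj z - \<i> * cnj u * (of_real k)\<^sup>2)
     (of_real (r\<^sup>2 * k\<^sup>2 - (cmod z)\<^sup>2)) (\<i> * (of_real r)\<^sup>2 * v + z * cnj u) =
   of_real (r\<^sup>2 * k\<^sup>2 - (cmod z)\<^sup>2) * det (metric_matrix r s k u v z)"
proof -
  have cnj: "cnj ((of_real r)\<^sup>2 * (of_real k)\<^sup>2 - z * cnj z) = (of_real r)\<^sup>2 * (of_real k)\<^sup>2 - z * cnj z"
    by simp
  show ?thesis
    unfolding complex_minor hermitian_square_def det_3 metric_matrix_def vector_3 cnj
    by (simp add: algebra_simps power2_eq_square)
qed

context adapted_coframe_metric
begin

lemma hermitian_square_pos: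
  assumes "metric_coefficients \<zeta> \<omega> r s k u v z" "a \<noteq> 0 \<or> b \<noteq> 0 \<or> c \<noteq> 0"
  shows "Re (hermitian_square r s k u v z a b c) > 0"
proof -
  obtain X where X: "\<zeta> 1 [X] = a" "\<zeta> 2 [X] = b" "\<zeta> 3 [X] = c" by (rule zeta_surj)
  then have "X \<noteq> 0" using assms(2) by (auto simp: zeta_simps)
  have w: "(\<zeta> i \<and>\<^sub>f conj_form (\<zeta> j)) [X, J X] = - 2 * \<i> * (\<zeta> i [X] * cnj (\<zeta> j [X]))" for i j
    by (subst wedge_1_1) (simp_all add: conj_form_def zeta_length)
  have "2 * \<omega> [X, J X] = 2 * hermitian_square r s k u v z a b c"
    using assms(1)[unfolded metric_coefficients_def Let_def, rule_format, of "[X, J X]"]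
    by (simp add: w X hermitian_square_def algebra_simps)
  then show ?thesis using omega_pos[OF \<open>X \<noteq> 0\<close>] by simp
qed

text \<open>As in Sylvester's criterion, \<open>k\<^sup>2\<close>, the minor and the determinant are
  positive, hence so is every factor in front of the last bracket.\<close>

lemma K1_eq:
  assumes "metric_coefficients \<zeta> \<omega> r s k u v z"
  obtains c where "c > 0" "K1 \<rho> l x r s k u v z = c * (\<rho> + l\<^sup>2 - 2 * x)"
proof -
  note pos = hermitian_square_pos[OF assms]
  have k: "k\<^sup>2 > 0" using pos[of 0 0 1] by (simp add: hermitian_square_def)
  define M where "M = r\<^sup>2 * k\<^sup>2 - (cmod z)\<^sup>2"
  have "0 < k\<^sup>2 * M"
    using pos[of "of_real (k\<^sup>2)" 0 "\<i> * z"] k unfolding hermitian_square_minor M_def[symmetric] by simp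
  then have "M > 0" using k by (simp add: zero_less_mult_iff)
  define D where "D = det (metric_matrix r s k u v z)"
  \<comment> \<open>The argument in \<open>hermitian_square_det\<close> is nonzero because its
    second entry is \<open>M\<close>.\<close>
  have "0 < Re (of_real M * D)"
    unfolding D_def using hermitian_square_det[of r s k u v z, folded M_def] pos \<open>M > 0\<close>
    by (metis less_numeral_extra(3) of_real_eq_0_iff)
  then have "Re D > 0" using \<open>M > 0\<close> by (simp add: zero_less_mult_iff)
  then have "norm_Psi r s k u v z > 0" by (simp add: norm_Psi_def D_def)
  then show ?thesis
    using that[of "norm_Psi r s k u v z * M * k\<^sup>2 / 8"] \<open>M > 0\<close> k
    by (simp add: K1_def M_def)
qed

lemma sgn_K1:
  assumes "metric_coefficients \<zeta> \<omega> r s k u v z"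
  shows "sgn (K1 \<rho> l x r s k u v z) = sgn (\<rho> + l\<^sup>2 - 2 * x)"
  by (rule K1_eq[OF assms]) (simp add: sgn_mult)

end

section \<open>Sign of \<open>K1\<close> and special Hermitian metrics\<close>

theorem proposition4p6:
  fixes br :: "'g::euclidean_space \<Rightarrow> 'g \<Rightarrow> 'g" and J :: "'g \<Rightarrow> 'g"
    and \<zeta> :: "3 \<Rightarrow> 'g form" and \<rho> l x y :: real
    and \<omega>0 :: "'g form" and r0 s0 k0 :: real and u0 v0 z0 :: complex
  assumes "DIM('g) = 6"
    and "two_step_nilpotent br"
    and "b1 br \<ge> 4"
    and "complex_structure br J"
    and "\<not> complex_parallelizable br J"
    and "adapted_coframe br J \<zeta> \<rho> l x y"
    and "hermitian_metric J \<omega>0"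
    and "metric_coefficients \<zeta> \<omega>0 r0 s0 k0 u0 v0 z0"
  shows "(\<forall>\<zeta>' \<rho>' l' x' y' \<omega>1 r1 s1 k1 u1 v1 z1.
            adapted_coframe br J \<zeta>' \<rho>' l' x' y' \<longrightarrow>
            hermitian_metric J \<omega>1 \<longrightarrow>
            metric_coefficients \<zeta>' \<omega>1 r1 s1 k1 u1 v1 z1 \<longrightarrow>
            sgn (K1 \<rho>' l' x' r1 s1 k1 u1 v1 z1) = sgn (K1 \<rho> l x r0 s0 k0 u0 v0 z0))
       \<and> (balanced br \<omega>0 \<longrightarrow> K1 \<rho> l x r0 s0 k0 u0 v0 z0 > 0)
       \<and> (locally_conformally_kaehler br \<omega>0 \<longrightarrow> K1 \<rho> l x r0 s0 k0 u0 v0 z0 < 0)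
       \<and> (pluriclosed br J \<omega>0 \<longleftrightarrow> K1 \<rho> l x r0 s0 k0 u0 v0 z0 = 0)"
proof -
  have metricI: "adapted_coframe_metric br J \<zeta>' \<rho>' l' x' y' \<omega>"
    if "adapted_coframe br J \<zeta>' \<rho>' l' x' y'" "hermitian_metric J \<omega>" for \<zeta>' \<rho>' l' x' y' \<omega>
    using that assms(2,4)
    by (simp add: adapted_coframe_metric_def adapted_coframe_metric_axioms_def
        adapted_coframe_algebra_def two_step_nilpotent_def complex_structure_def)
  interpret adapted_coframe_metric br J \<zeta> \<rho> l x y \<omega>0
    by (rule metricI[OF assms(6,7)])
  note sgn_K = sgn_K1[OF assms(8)]
  \<comment> \<open>The metric \<open>\<omega>1\<close> enters only through a positive factor, so
    the two coframes can be compared using \<open>\<omega>0\<close> for both.\<close>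
  have "sgn (K1 \<rho>' l' x' r1 s1 k1 u1 v1 z1) = sgn (K1 \<rho> l x r0 s0 k0 u0 v0 z0)"
    if "adapted_coframe br J \<zeta>' \<rho>' l' x' y'" "hermitian_metric J \<omega>1"
      "metric_coefficients \<zeta>' \<omega>1 r1 s1 k1 u1 v1 z1"
    for \<zeta>' \<rho>' l' x' y' \<omega>1 r1 s1 k1 u1 v1 z1
    using adapted_coframe_metric.sgn_K1[OF metricI[OF that(1,2)] that(3)] sgn_K
      adapted_coframe_sgn[OF adapted_coframe_metric_axioms metricI[OF that(1) assms(7)]]
    by simp
  moreover have "balanced br \<omega>0 \<longrightarrow> K1 \<rho> l x r0 s0 k0 u0 v0 z0 > 0"
    using balanced_imp_pos sgn_K by (metis sgn_greater)
  moreover have "locally_conformally_kaehler br \<omega>0 \<longrightarrow> K1 \<rho> l x r0 s0 k0 u0 v0 z0 < 0"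
    using lck_imp_neg sgn_K by (metis sgn_less)
  moreover have "pluriclosed br J \<omega>0 \<longleftrightarrow> K1 \<rho> l x r0 s0 k0 u0 v0 z0 = 0"
    using pluriclosed_iff sgn_K by (metis sgn_eq_0_iff)
  ultimately show ?thesis by blast
qed

end
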